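(* Let $\Gamma$ be a non-trivial, torsion-free, countable abelian group. Then every orbit of the conjugation action of $\mathrm{Iso}(\mathbb{U})$ on $\mathrm{Hom}(\Gamma,\mathrm{Iso}(\mathbb{U}))$ (i.e., every conjugacy class) is meager in $\mathrm{Hom}(\Gamma,\mathrm{Iso}(\mathbb{U}))$.
   Context: $\mathrm{Iso}(\mathbb{U})$ is the isometry group of the Urysohn space with the pointwise convergence topology. $\mathrm{Hom}(\Gamma,G)$ has the topology from $G^\Gamma$, and $G$ acts on it by $(g\cdot\pi)(\gamma)=g\pi(\gamma)g^{-1}$. *)

theory Defs
  imports "HOL-Analysis.Analysis"
begin

text \<open>Urysohn space: a complete separable metric space with the finite (Katetov)
extension property. This characterises the Urysohn space U up to isometry.\<close>
definition katetov_on :: "'u::metric_space set \<Rightarrow> ('u \<Rightarrow> real) \<Rightarrow> bool" where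
  "katetov_on A f \<longleftrightarrow> (\<forall>x\<in>A. \<forall>y\<in>A. \<bar>f x - f y\<bar> \<le> dist x y \<and> dist x y \<le> f x + f y)"

definition urysohn_space :: "'u::metric_space itself \<Rightarrow> bool" where
  "urysohn_space TYPE('u) \<longleftrightarrow>
     complete (UNIV :: 'u set) \<and>
     separable_space (euclidean :: 'u topology) \<and>
     (\<forall>A f. finite (A :: 'u set) \<and> katetov_on A f \<longrightarrow> (\<exists>z. \<forall>x\<in>A. dist z x = f x))"

definition Iso :: "('u::metric_space \<Rightarrow> 'u) set" where
  "Iso = {g. bij g \<and> (\<forall>x y. dist (g x) (g y) = dist x y)}"

text \<open>Hom(Gamma, Iso(U)) for an additively written abelian group Gamma.
It carries the subspace topology of the product (pointwise convergence) topology
on Gamma \<Rightarrow> (U \<Rightarrow> U), i.e. of Iso(U)^Gamma.\<close>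
definition Hom_Iso :: "('g::ab_group_add \<Rightarrow> ('u::metric_space \<Rightarrow> 'u)) set" where
  "Hom_Iso = {\<pi>. (\<forall>\<gamma>. \<pi> \<gamma> \<in> Iso) \<and> (\<forall>a b. \<pi> (a + b) = \<pi> a \<circ> \<pi> b)}"

definition conj_orbit :: "('g::ab_group_add \<Rightarrow> ('u::metric_space \<Rightarrow> 'u)) \<Rightarrow> ('g \<Rightarrow> ('u \<Rightarrow> 'u)) set" where
  "conj_orbit \<pi> = {(\<lambda>\<gamma>. g \<circ> \<pi> \<gamma> \<circ> inv g) | g. g \<in> Iso}"

definition nowhere_dense_in :: "'a topology \<Rightarrow> 'a set \<Rightarrow> bool" where
  "nowhere_dense_in X S \<longleftrightarrow> S \<subseteq> topspace X \<and> X interior_of (X closure_of S) = {}"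

definition meager_in :: "'a topology \<Rightarrow> 'a set \<Rightarrow> bool" where
  "meager_in X S \<longleftrightarrow> (\<exists>\<F>. countable \<F> \<and> (\<forall>N\<in>\<F>. nowhere_dense_in X N) \<and> S \<subseteq> \<Union>\<F>)"

definition torsion_free :: "'g::ab_group_add itself \<Rightarrow> bool" where
  "torsion_free TYPE('g) \<longleftrightarrow> (\<forall>(x::'g) n. n > 0 \<and> ((+) x ^^ n) 0 = 0 \<longrightarrow> x = 0)"

end

theory Submission
  imports Defs
begin

text \<open>The argument follows Rosendal. Fix \<open>x \<noteq> 0\<close>. For every infinite \<open>S \<subseteq> \<nat>\<close>, a generic action
makes \<open>n x\<close>, for suitable \<open>n \<in> S\<close>, move any given point as little as we like. If \<open>\<pi> x \<noteq> id\<close>,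
some point is moved by at least \<open>\<delta> > 0\<close> by \<open>\<pi> (n x)\<close> for infinitely many \<open>n\<close>, for otherwise
\<open>\<pi> (n x)\<close> and \<open>\<pi> ((n + 1) x) = \<pi> x \<circ> \<pi> (n x)\<close> both tend to the identity; so the orbit
misses the generic actions. If \<open>\<pi> x = id\<close>, the orbit lies in the nowhere dense set of actions
in which \<open>x\<close> acts trivially.

Density comes from an approximation property: any action can be perturbed, over finite data, to
one in which a prescribed subgroup, avoiding a suitable finite set, hardly moves given points and
all other elements act non-trivially. The perturbed
action is obtained from an invariant pseudometric on finitely many copies of \<open>\<Gamma>\<close>. One adds one
copy at a time by Katetov amalgamation while embedding more and more points into the Urysohn
space, so that in the limit countably many copies are embedded with dense image.\<close>

section \<open>Translation-invariant pseudometrics\<close>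

text \<open>The pair \<open>(g, i)\<close> stands for the image under \<open>g\<close> of the \<open>i\<close>-th generating point of a
\<open>\<Gamma>\<close>-space. In the locale below only the first \<open>m\<close> orbits are constrained.\<close>

definition tr :: "'g::ab_group_add \<Rightarrow> 'g \<times> nat \<Rightarrow> 'g \<times> nat" where
  "tr c p = (c + fst p, snd p)"

lemma snd_tr [simp]: "snd (tr c p) = snd p"
  by (simp add: tr_def)

lemma fst_tr [simp]: "fst (tr c p) = c + fst p"
  by (simp add: tr_def)

lemma tr_tr [simp]: "tr a (tr b p) = tr (a + b) p"
  by (simp add: tr_def add.assoc)

lemma tr_0 [simp]: "tr 0 p = p"
  by (simp add: tr_def)

lemma tr_eq_iff [simp]: "tr c p = tr c q \<longleftrightarrow> p = q"
  by (auto simp: tr_def prod_eq_iff)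

locale inv_pmetric =
  fixes m :: nat and d :: "'g::ab_group_add \<times> nat \<Rightarrow> 'g \<times> nat \<Rightarrow> real"
  assumes zero: "snd x < m \<Longrightarrow> d x x = 0"
    and sym: "snd x < m \<Longrightarrow> snd y < m \<Longrightarrow> d x y = d y x"
    and tri: "snd x < m \<Longrightarrow> snd y < m \<Longrightarrow> snd z < m \<Longrightarrow> d x z \<le> d x y + d y z"
    and inv: "snd x < m \<Longrightarrow> snd y < m \<Longrightarrow> d (tr c x) (tr c y) = d x y"
begin

lemma nonneg: "snd x < m \<Longrightarrow> snd y < m \<Longrightarrow> 0 \<le> d x y"
  using tri[of x y x] zero[of x] sym[of x y] by simp

end

lemma INF_lower_real:
  fixes f :: "'a \<Rightarrow> real"
  assumes "\<And>x. x \<in> A \<Longrightarrow> 0 \<le> f x" "x \<in> A"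
  shows "(INF x\<in>A. f x) \<le> f x"
  using assms by (intro cINF_lower bdd_belowI2[of _ 0]) auto

text \<open>Two distinct points with Katetov functions \<open>k p\<close>, \<open>k q\<close> over a common base \<open>C\<close> may be
placed at distance \<open>inf (k p + k q)\<close>, the largest distance that the base allows.\<close>

lemma katetov_amalgam_triangle:
  fixes k :: "'p \<Rightarrow> 'x \<Rightarrow> real" and d :: "'x \<Rightarrow> 'x \<Rightarrow> real"
  assumes "C \<noteq> {}"
    and lip: "\<And>p x y. p \<in> P \<Longrightarrow> x \<in> C \<Longrightarrow> y \<in> C \<Longrightarrow> k p x \<le> k p y + d x y"
    and kat: "\<And>p x y. p \<in> P \<Longrightarrow> x \<in> C \<Longrightarrow> y \<in> C \<Longrightarrow> d x y \<le> k p x + k p y"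
    and pos: "\<And>p x. p \<in> P \<Longrightarrow> x \<in> C \<Longrightarrow> 0 \<le> k p x"
    and pqr: "p \<in> P" "q \<in> P" "r \<in> P"
  shows "(INF x\<in>C. k p x + k r x) \<le> (INF x\<in>C. k p x + k q x) + (INF x\<in>C. k q x + k r x)"
proof -
  let ?I = "\<lambda>p q. INF x\<in>C. k p x + k q x"
  have "?I p r \<le> (k p x + k q x) + (k q y + k r y)" if x: "x \<in> C" and y: "y \<in> C" for x y
  proof -
    have "?I p r \<le> k p x + k r x"
      using x pqr pos by (intro INF_lower_real) auto
    \<comment> \<open>Both halves go through the middle point \<open>q\<close>: \<open>k r x\<close>
      is at most \<open>k r y + d x y\<close>, and \<open>d x y\<close> is at most
      \<open>k q x + k q y\<close>.\<close>
    with lip[OF pqr(3) x y] kat[OF pqr(2) x y] show ?thesis by linarith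
  qed
  then have le: "?I p r - (k p x + k q x) \<le> k q y + k r y" if "x \<in> C" "y \<in> C" for x y
    using that by (simp add: diff_le_eq add.commute)
  have "?I p r - (k p x + k q x) \<le> ?I q r" if "x \<in> C" for x
    using le[OF that] by (rule cINF_greatest[OF \<open>C \<noteq> {}\<close>])
  then have "?I p r - ?I q r \<le> ?I p q"
    by (intro cINF_greatest[OF \<open>C \<noteq> {}\<close>]) (simp add: algebra_simps)
  then show ?thesis by linarith
qed

text \<open>The canonical extension of \<open>f\<close> to the whole base is carried along by
  translation to the other points of the new orbit. All remaining distances are then given by the
  Katetov amalgam, which involves no choices and is therefore invariant.\<close>

lemma (in inv_pmetric) new_orbit:
  assumes "E \<noteq> {}" and E: "\<And>e. e \<in> E \<Longrightarrow> snd e < m"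
    and f_lip: "\<And>e e'. e \<in> E \<Longrightarrow> e' \<in> E \<Longrightarrow> f e \<le> f e' + d e e'"
    and f_kat: "\<And>e e'. e \<in> E \<Longrightarrow> e' \<in> E \<Longrightarrow> d e e' \<le> f e + f e'"
  shows "\<exists>d'. inv_pmetric (Suc m) d' \<and> (\<forall>x y. snd x < m \<longrightarrow> snd y < m \<longrightarrow> d' x y = d x y) \<and>
              (\<forall>e\<in>E. d' (0, m) e = f e)"
proof -
  define C :: "('g \<times> nat) set" where "C = {x. snd x < m}"
  \<comment> \<open>The largest 1-Lipschitz extension of \<open>f\<close> from \<open>E\<close> to
    the base \<open>C\<close>.\<close>
  define h where "h x = (INF e\<in>E. f e + d e x)" for x
  \<comment> \<open>\<open>k p\<close> is the intended distance from \<open>p\<close> to the base. A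
    new point is first translated back to \<open>(0, m)\<close>.\<close>
  define k where "k p x = (if snd p < m then d p x else h (tr (- fst p) x))" for p x
  \<comment> \<open>The diagonal is set apart because for a new point the infimum is twice its
    distance to the base, which may be positive.\<close>
  define d' where "d' p q = (if p = q then 0 else INF x\<in>C. k p x + k q x)" for p q
  have EC: "e \<in> C" if "e \<in> E" for e using E that by (simp add: C_def)
  have C0: "C \<noteq> {}" using EC \<open>E \<noteq> {}\<close> by auto
  have f0: "0 \<le> f e" if "e \<in> E" for e
    using f_kat[OF that that] zero[OF E[OF that]] by simp
  have fd0: "0 \<le> f e + d e x" if "e \<in> E" "x \<in> C" for e x
    using f0 nonneg[of e x] E that by (simp add: C_def)
  have h_le: "h x \<le> f e + d e x" if "e \<in> E" "x \<in> C" for e x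
    unfolding h_def using fd0 that by (intro INF_lower_real) auto
  have h_ge: "a \<le> h x" if "\<And>e. e \<in> E \<Longrightarrow> a \<le> f e + d e x" for a x
    unfolding h_def using that \<open>E \<noteq> {}\<close> by (intro cINF_greatest) auto
  have h0: "0 \<le> h x" if "x \<in> C" for x
    using fd0 that by (intro h_ge)
  have h_lip: "h x \<le> h y + d x y" if x: "x \<in> C" and y: "y \<in> C" for x y
  proof -
    have "h x - d x y \<le> f e + d e y" if "e \<in> E" for e
      using h_le[OF that x] tri[of e y x] E[OF that] sym[of x y] x y by (auto simp: C_def)
    then show ?thesis using h_ge[of "h x - d x y" y] by auto
  qed
  have h_kat: "d x y \<le> h x + h y" if x: "x \<in> C" and y: "y \<in> C" for x y
  proof -
    have *: "d x y - (f e + d e x) \<le> f e' + d e' y" if "e \<in> E" "e' \<in> E" for e e'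
      using f_kat[OF that] tri[of x e y] tri[of e e' y] sym[of x e] x y E[OF that(1)] E[OF that(2)]
      by (auto simp: C_def)
    have "d x y - (f e + d e x) \<le> h y" if "e \<in> E" for e
      using *[OF that] by (rule h_ge)
    then have "d x y - h y \<le> h x" by (intro h_ge) (simp add: algebra_simps)
    then show ?thesis by simp
  qed
  have h_eq: "h e = f e" if "e \<in> E" for e
  proof (rule antisym)
    show "h e \<le> f e" using h_le[OF that EC[OF that]] zero[OF E[OF that]] by simp
    show "f e \<le> h e"
      using f_lip[OF that] sym[of e] E that by (intro h_ge) auto
  qed
  have trC: "tr c x \<in> C" if "x \<in> C" for c x using that by (simp add: C_def)
  have inv': "d (tr c x) (tr c y) = d x y" if "x \<in> C" "y \<in> C" for c x y
    using inv that by (simp add: C_def)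
  have k_lip: "k p x \<le> k p y + d x y" if "x \<in> C" "y \<in> C" for p x y
    using h_lip[OF trC trC, OF that, of "- fst p" "- fst p"] inv'[OF that] tri[of p y x] sym[of x y] that
    by (auto simp: k_def C_def)
  have k_kat: "d x y \<le> k p x + k p y" if "x \<in> C" "y \<in> C" for p x y
    using h_kat[OF trC trC, OF that, of "- fst p" "- fst p"] inv'[OF that] tri[of x p y] sym[of x p] that
    by (auto simp: k_def C_def)
  have k0: "0 \<le> k p x" if "x \<in> C" for p x
    using h0[OF trC[OF that]] nonneg[of p x] that by (auto simp: k_def C_def)
  have k_tr: "k (tr c p) (tr c x) = k p x" if "x \<in> C" for c p x
    using inv that by (auto simp: k_def C_def)
  \<comment> \<open>For \<open>x\<close> in the base the infimum is attained at \<open>x\<close>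
    itself, where \<open>k x x = 0\<close>.\<close>
  have d'_base: "d' p x = k p x" if x: "x \<in> C" and "p \<noteq> x" for p x
  proof -
    have "(INF y\<in>C. k p y + k x y) = k p x"
    proof (rule antisym)
      have "(INF y\<in>C. k p y + k x y) \<le> k p x + k x x"
        using x k0 by (intro INF_lower_real) auto
      also have "k x x = 0" using x zero by (simp add: k_def C_def)
      finally show "(INF y\<in>C. k p y + k x y) \<le> k p x" by simp
      show "k p x \<le> (INF y\<in>C. k p y + k x y)"
        using C0 k_lip[OF x, of _ p] x by (intro cINF_greatest) (auto simp: k_def C_def)
    qed
    then show ?thesis using that by (simp add: d'_def)
  qed
  have d'0: "0 \<le> d' p q" for p q
    unfolding d'_def by (auto intro!: cINF_greatest[OF C0] add_nonneg_nonneg k0)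
  have "inv_pmetric (Suc m) d'"
  proof
    show "d' p p = 0" for p by (simp add: d'_def)
    show sym': "d' p q = d' q p" for p q by (simp add: d'_def add.commute)
    show "d' p r \<le> d' p q + d' q r" for p q r
    proof (cases "p = q \<or> q = r \<or> p = r")
      case True
      then show ?thesis using d'0[of p q] d'0[of q r] by (auto simp: d'_def)
    next
      case False
      then show ?thesis
        using katetov_amalgam_triangle[where P = UNIV and k = k and d = d, OF C0 k_lip k_kat k0, of p q r]
        by (auto simp: d'_def)
    qed
    show "d' (tr c p) (tr c q) = d' p q" for c p q
    proof -
      have "C = tr c ` C"
      proof (intro equalityI subsetI)
        fix x assume "x \<in> C"
        then have "x = tr c (tr (- c) x)" "tr (- c) x \<in> C" by (auto simp: trC)
        then show "x \<in> tr c ` C" by blast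
      qed (auto simp: trC)
      then have "(INF x\<in>C. k (tr c p) x + k (tr c q) x) = (INF x\<in>tr c ` C. k (tr c p) x + k (tr c q) x)"
        by simp
      also have "\<dots> = (INF x\<in>C. k p x + k q x)"
        using k_tr by (simp add: image_image cong: image_cong)
      finally show ?thesis by (simp add: d'_def)
    qed
  qed
  moreover have "d' x y = d x y" if "snd x < m" "snd y < m" for x y
    using d'_base[of y x] zero[of x] that by (cases "x = y") (auto simp: C_def k_def d'_def)
  moreover have "d' (0, m) e = f e" if "e \<in> E" for e
    using d'_base[OF EC[OF that], of "(0, m)"] E[OF that] h_eq[OF that] by (cases e) (auto simp: k_def)
  ultimately show ?thesis by blast
qed

section \<open>Building invariant dense families in the Urysohn space\<close>

definition realizes :: "('g::ab_group_add \<times> nat) set \<Rightarrow> ('g \<times> nat \<Rightarrow> 'g \<times> nat \<Rightarrow> real) \<Rightarrow>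
    ('g \<times> nat \<Rightarrow> 'u::metric_space) \<Rightarrow> bool" where
  "realizes E d \<phi> \<longleftrightarrow> (\<forall>x\<in>E. \<forall>y\<in>E. dist (\<phi> x) (\<phi> y) = d x y)"

text \<open>The required distances from \<open>v\<close> to the placed points, together with a
  suitable distance to \<open>u\<close>, form a Katetov function on a finite set, so the extension
  property of the Urysohn space supplies \<open>v\<close>.\<close>

lemma urysohn_near_extension:
  fixes \<phi> :: "'g::ab_group_add \<times> nat \<Rightarrow> 'u::metric_space"
  assumes U: "urysohn_space TYPE('u)" and "inv_pmetric m d"
    and E: "finite E" "\<And>x. x \<in> E \<Longrightarrow> snd x < m" and q: "snd q < m"
    and \<phi>: "realizes E d \<phi>" and "0 \<le> \<delta>"
    and \<delta>: "\<And>x. x \<in> E \<Longrightarrow> \<bar>d q x - dist u (\<phi> x)\<bar> \<le> \<delta>"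
  shows "\<exists>v. (\<forall>x\<in>E. dist v (\<phi> x) = d q x) \<and> dist v u \<le> \<delta>"
proof (cases "E = {}")
  case True
  then show ?thesis using \<open>0 \<le> \<delta>\<close> by (intro exI[of _ u]) auto
next
  case False
  interpret inv_pmetric m d by fact
  \<comment> \<open>The Katetov inequalities force the distance to \<open>u\<close> to be at least
    each of these discrepancies; \<open>r\<close> is the least value that meets them all.\<close>
  define r where "r = Max ((\<lambda>x. \<bar>d q x - dist u (\<phi> x)\<bar>) ` E)"
  have r_ge: "\<bar>d q x - dist u (\<phi> x)\<bar> \<le> r" if "x \<in> E" for x
    unfolding r_def using E that by (intro Max_ge) auto
  obtain x0 where x0: "x0 \<in> E" "r = \<bar>d q x0 - dist u (\<phi> x0)\<bar>"
    using Max_in[of "(\<lambda>x. \<bar>d q x - dist u (\<phi> x)\<bar>) ` E"] E(1) False unfolding r_def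
    by (metis (no_types, lifting) finite_imageI image_is_empty imageE)
  have d\<phi>: "dist (\<phi> x) (\<phi> y) = d x y" if "x \<in> E" "y \<in> E" for x y
    using \<phi> that by (auto simp: realizes_def)
  have le1: "\<bar>d q x - d q y\<bar> \<le> d x y \<and> d x y \<le> d q x + d q y" if "x \<in> E" "y \<in> E" for x y
  proof -
    have xy: "snd x < m" "snd y < m" using E(2) that by auto
    show ?thesis
      using tri[OF q xy] tri[OF q xy(2,1)] tri[OF xy(1) q xy(2)] sym[OF xy] sym[OF xy(1) q]
      by linarith
  qed
  \<comment> \<open>If \<open>u\<close> is already a placed point, its prescribed distance takes
    precedence over \<open>r\<close>. Several points of \<open>E\<close> may share an image, but
    these are at \<open>d\<close>-distance 0 from each other, so the choice of preimage is
    immaterial.\<close>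
  define f where "f w = (if w \<in> \<phi> ` E then d q (inv_into E \<phi> w) else r)" for w
  have f\<phi>: "f (\<phi> x) = d q x" if "x \<in> E" for x
  proof -
    let ?y = "inv_into E \<phi> (\<phi> x)"
    have y: "?y \<in> E" "\<phi> ?y = \<phi> x"
      using that by (auto intro: inv_into_into f_inv_into_f)
    with le1[OF that y(1)] d\<phi>[OF that y(1)] that show ?thesis by (auto simp: f_def)
  qed
  have fu: "\<bar>d q x - f u\<bar> \<le> dist u (\<phi> x) \<and> dist u (\<phi> x) \<le> d q x + f u \<and> f u \<le> \<delta> \<and> 0 \<le> f u"
    if "x \<in> E" for x
  proof (cases "u \<in> \<phi> ` E")
    case True
    then obtain y where y: "y \<in> E" "u = \<phi> y" by auto
    then have "f u = d q y" "dist u (\<phi> x) = d x y" "0 \<le> d q y" "f u \<le> \<delta>"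
      using d\<phi>[OF that y(1)] f\<phi>[OF y(1)] \<delta>[OF y(1)] nonneg[OF q E(2)] by (auto simp: dist_commute)
    then show ?thesis using le1[OF that y(1)] by linarith
  next
    case False
    then have "f u = r" by (simp add: f_def)
    moreover have "r \<le> d q x + dist u (\<phi> x)"
      using x0(2) le1[OF that x0(1)] d\<phi>[OF that x0(1)] dist_triangle[of "\<phi> x" "\<phi> x0" u]
        dist_triangle[of u "\<phi> x0" "\<phi> x"] dist_commute[of u "\<phi> x"] by linarith
    ultimately show ?thesis using r_ge[OF that] \<delta>[OF x0(1)] x0(2) by linarith
  qed
  have "katetov_on (insert u (\<phi> ` E)) f"
    unfolding katetov_on_def using fu f\<phi> le1 d\<phi> False
    by (auto simp: dist_commute abs_minus_commute add.commute)
  moreover have "finite (insert u (\<phi> ` E))" using E by simp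
  ultimately obtain z where "\<forall>x\<in>insert u (\<phi> ` E). dist z x = f x"
    using U unfolding urysohn_space_def by blast
  then show ?thesis using f\<phi> fu x0 by (intro exI[of _ z]) auto
qed

lemma realizes_insert:
  assumes "inv_pmetric m d" and "\<And>x. x \<in> insert q E \<Longrightarrow> snd x < m" and "realizes E d \<phi>"
    and "q \<notin> E" and "\<And>x. x \<in> E \<Longrightarrow> dist v (\<phi> x) = d q x"
  shows "realizes (insert q E) d (\<phi>(q := v))"
proof -
  interpret inv_pmetric m d by fact
  have q: "snd q < m" and E: "\<And>x. x \<in> E \<Longrightarrow> snd x < m" using assms(2) by auto
  have dq: "dist v (\<phi> x) = d q x" "dist (\<phi> x) v = d x q" if "x \<in> E" for x
    using assms(5)[OF that] sym[OF q E[OF that]] by (simp_all add: dist_commute)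
  show ?thesis
    using \<open>realizes E d \<phi>\<close> zero[OF q] dq \<open>q \<notin> E\<close> unfolding realizes_def by auto
qed

lemma urysohn_extension:
  fixes \<phi> :: "'g::ab_group_add \<times> nat \<Rightarrow> 'u::metric_space"
  assumes U: "urysohn_space TYPE('u)" and d: "inv_pmetric m d"
    and E: "finite E" "\<And>x. x \<in> E \<Longrightarrow> snd x < m" and \<phi>: "realizes E d \<phi>"
    and B: "finite B" "\<And>x. x \<in> B \<Longrightarrow> snd x < m"
  shows "\<exists>\<phi>'. (\<forall>x\<in>E. \<phi>' x = \<phi> x) \<and> realizes (E \<union> B) d \<phi>'"
  using B
proof (induction B)
  case empty
  then show ?case using \<phi> by auto
next
  case (insert q B)
  then obtain \<phi>' where \<phi>': "\<forall>x\<in>E. \<phi>' x = \<phi> x" "realizes (E \<union> B) d \<phi>'" by auto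
  show ?case
  proof (cases "q \<in> E \<union> B")
    case True
    then have "E \<union> insert q B = E \<union> B" by auto
    then show ?thesis using \<phi>' by auto
  next
    case False
    \<comment> \<open>Only the exact distances to the placed points matter here, so the reference
      point is arbitrary and \<open>\<delta>\<close> is any bound for the discrepancies; the sum
      also covers the empty set.\<close>
    define \<delta> where "\<delta> = (\<Sum>x\<in>E \<union> B. \<bar>d q x - dist undefined (\<phi>' x)\<bar>)"
    have fin: "finite (E \<union> B)" using E insert by auto
    have "0 \<le> \<delta>" unfolding \<delta>_def by (intro sum_nonneg) auto
    moreover have "\<bar>d q x - dist undefined (\<phi>' x)\<bar> \<le> \<delta>" if "x \<in> E \<union> B" for x
      unfolding \<delta>_def using that fin
      by (intro member_le_sum[where f = "\<lambda>x. \<bar>d q x - dist undefined (\<phi>' x)\<bar>"]) auto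
    ultimately obtain v where "\<forall>x\<in>E \<union> B. dist v (\<phi>' x) = d q x"
      using urysohn_near_extension[OF U d fin _ _ \<phi>'(2), of q \<delta> undefined] E insert.prems by blast
    then have "realizes (insert q (E \<union> B)) d (\<phi>'(q := v))"
      using False by (intro realizes_insert[OF d _ \<phi>'(2)]) (use E insert.prems in blast)+
    moreover have "\<forall>x\<in>E. (\<phi>'(q := v)) x = \<phi> x" using \<phi>' False by auto
    ultimately show ?thesis by (metis Un_insert_right)
  qed
qed

text \<open>Points are placed one at a time. Each new point has to absorb the displacement of the
  earlier ones plus a further \<open>\<eta>\<close>, so the error grows linearly in the number of
  points.\<close>

lemma urysohn_perturbation:
  fixes \<psi> :: "'g::ab_group_add \<times> nat \<Rightarrow> 'u::metric_space"
  assumes U: "urysohn_space TYPE('u)" and d: "inv_pmetric m d" and "0 \<le> \<eta>"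
    and "finite E" "\<And>x. x \<in> E \<Longrightarrow> snd x < m"
    and "\<And>x y. x \<in> E \<Longrightarrow> y \<in> E \<Longrightarrow> \<bar>d x y - dist (\<psi> x) (\<psi> y)\<bar> \<le> \<eta>"
  shows "\<exists>\<phi>. realizes E d \<phi> \<and> (\<forall>x\<in>E. dist (\<phi> x) (\<psi> x) \<le> real (card E) * \<eta>)"
  using assms(4-)
proof (induction E)
  case empty
  then show ?case by (auto simp: realizes_def)
next
  case (insert q E)
  then obtain \<phi> where \<phi>: "realizes E d \<phi>" "\<forall>x\<in>E. dist (\<phi> x) (\<psi> x) \<le> real (card E) * \<eta>"
    by auto
  let ?\<delta> = "real (card (insert q E)) * \<eta>"
  have \<delta>: "?\<delta> = real (card E) * \<eta> + \<eta>" using insert by (simp add: algebra_simps)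
  have "\<bar>d q x - dist (\<psi> q) (\<phi> x)\<bar> \<le> ?\<delta>" if "x \<in> E" for x
  proof -
    have "\<bar>d q x - dist (\<psi> q) (\<psi> x)\<bar> \<le> \<eta>" "dist (\<phi> x) (\<psi> x) \<le> real (card E) * \<eta>"
      using insert.prems(2)[of q x] \<phi> that by auto
    then show ?thesis
      using dist_triangle[of "\<psi> q" "\<phi> x" "\<psi> x"] dist_triangle[of "\<psi> q" "\<psi> x" "\<phi> x"]
      unfolding \<delta> by (simp add: dist_commute)
  qed
  moreover have "0 \<le> ?\<delta>" using \<open>0 \<le> \<eta>\<close> by simp
  ultimately obtain v where v: "\<forall>x\<in>E. dist v (\<phi> x) = d q x" "dist v (\<psi> q) \<le> ?\<delta>"
    using urysohn_near_extension[OF U d insert.hyps(1) _ _ \<phi>(1), of q ?\<delta> "\<psi> q"] insert.prems by auto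
  have "realizes (insert q E) d (\<phi>(q := v))"
    using insert v by (intro realizes_insert[OF d _ \<phi>(1)]) auto
  moreover have "dist ((\<phi>(q := v)) x) (\<psi> x) \<le> ?\<delta>" if "x \<in> insert q E" for x
    using that v \<phi> \<open>0 \<le> \<eta>\<close> unfolding \<delta> by (auto intro: add_increasing2)
  ultimately show ?case by blast
qed

text \<open>A finite stage of the construction: an invariant pseudometric on \<open>m\<close> orbits, only
finitely many points of which (the set \<open>E\<close>) are already placed in the Urysohn space.\<close>

definition stage :: "nat \<Rightarrow> ('g::ab_group_add \<times> nat \<Rightarrow> 'g \<times> nat \<Rightarrow> real) \<Rightarrow> ('g \<times> nat) set \<Rightarrow>
    ('g \<times> nat \<Rightarrow> 'u::metric_space) \<Rightarrow> bool" where
  "stage m d E \<phi> \<longleftrightarrow> inv_pmetric m d \<and> finite E \<and> E \<noteq> {} \<and> (\<forall>x\<in>E. snd x < m) \<and> realizes E d \<phi>"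

text \<open>The base point of a new orbit is placed exactly at \<open>u\<close>, its distances to
  the placed points being read off in the Urysohn space; then the points of \<open>B\<close> are
  placed. The target \<open>u\<close> serves density in the limit, and \<open>B\<close> serves
  exhaustion.\<close>

lemma stage_step:
  fixes \<phi> :: "'g::ab_group_add \<times> nat \<Rightarrow> 'u::metric_space"
  assumes U: "urysohn_space TYPE('u)" and st: "stage m d E \<phi>"
    and B: "finite B" "\<And>x. x \<in> B \<Longrightarrow> snd x < Suc m"
  shows "\<exists>d' E' \<phi>'. stage (Suc m) d' E' \<phi>' \<and>
     (\<forall>x y. snd x < m \<longrightarrow> snd y < m \<longrightarrow> d' x y = d x y) \<and>
     E \<union> B \<subseteq> E' \<and> (\<forall>x\<in>E. \<phi>' x = \<phi> x) \<and> u \<in> \<phi>' ` E'"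
proof -
  have d: "inv_pmetric m d" and E: "finite E" "E \<noteq> {}" "\<And>x. x \<in> E \<Longrightarrow> snd x < m"
    and \<phi>: "realizes E d \<phi>"
    using st by (auto simp: stage_def)
  interpret inv_pmetric m d by fact
  have d\<phi>: "d x y = dist (\<phi> x) (\<phi> y)" if "x \<in> E" "y \<in> E" for x y
    using \<phi> that by (auto simp: realizes_def)
  have "\<exists>d'. inv_pmetric (Suc m) d' \<and> (\<forall>x y. snd x < m \<longrightarrow> snd y < m \<longrightarrow> d' x y = d x y) \<and>
              (\<forall>e\<in>E. d' (0, m) e = dist u (\<phi> e))"
  proof (rule new_orbit)
    fix e e' assume e: "e \<in> E" "e' \<in> E"
    show "dist u (\<phi> e) \<le> dist u (\<phi> e') + d e e'"
      using dist_triangle[of u "\<phi> e" "\<phi> e'"] d\<phi>[OF e] by (simp add: dist_commute)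
    show "d e e' \<le> dist u (\<phi> e) + dist u (\<phi> e')"
      using dist_triangle3[of "\<phi> e" "\<phi> e'" u] d\<phi>[OF e] by simp
  qed (use E in auto)
  then obtain d' where d': "inv_pmetric (Suc m) d'"
    "\<And>x y. snd x < m \<Longrightarrow> snd y < m \<Longrightarrow> d' x y = d x y"
    "\<And>e. e \<in> E \<Longrightarrow> d' (0, m) e = dist u (\<phi> e)" by blast
  let ?q = "(0::'g, m)"
  have q: "?q \<notin> E" using E(3)[of ?q] by auto
  have "realizes E d' \<phi>" using \<phi> d'(2) E by (auto simp: realizes_def)
  then have "realizes (insert ?q E) d' (\<phi>(?q := u))"
    using E(3) d'(3) q by (intro realizes_insert[OF d'(1)]) (auto simp: less_Suc_eq)
  moreover have "\<And>x. x \<in> insert ?q E \<Longrightarrow> snd x < Suc m" using E(3) by (auto simp: less_Suc_eq)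
  ultimately obtain \<phi>' where \<phi>': "\<forall>x\<in>insert ?q E. \<phi>' x = (\<phi>(?q := u)) x"
      "realizes (insert ?q E \<union> B) d' \<phi>'"
    using urysohn_extension[OF U d'(1), of "insert ?q E" "\<phi>(?q := u)" B] B E by blast
  have "stage (Suc m) d' (insert ?q E \<union> B) \<phi>'"
    using d'(1) \<phi>'(2) E B by (auto simp: stage_def less_Suc_eq)
  moreover have "u \<in> \<phi>' ` (insert ?q E \<union> B)" using \<phi>'(1) by force
  moreover have "\<forall>x\<in>E. \<phi>' x = \<phi> x" using \<phi>'(1) q by auto
  ultimately show ?thesis using d'(2)
    by (intro exI[of _ d'] exI[of _ "insert ?q E \<union> B"] exI[of _ \<phi>']) auto
qed

section \<open>The dense limit family and the action it carries\<close>

lemma urysohn_dense_sequence: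
  assumes "urysohn_space TYPE('u::metric_space)"
  shows "\<exists>b::nat \<Rightarrow> 'u. \<forall>x \<epsilon>. 0 < \<epsilon> \<longrightarrow> (\<exists>n. dist (b n) x < \<epsilon>)"
proof -
  obtain D :: "'u set" where D: "countable D" "closure D = UNIV"
    using assms unfolding urysohn_space_def separable_space_def by auto
  then have "D \<noteq> {}" by auto
  then have r: "range (from_nat_into D) = D" using D by (simp add: range_from_nat_into)
  have "\<exists>n. dist (from_nat_into D n) x < \<epsilon>" if \<epsilon>: "0 < \<epsilon>" for x \<epsilon>
  proof -
    have "x \<in> closure D" using D by simp
    then obtain y where "y \<in> D" "dist y x < \<epsilon>"
      using \<epsilon> unfolding closure_approachable by blast
    then show ?thesis using r by (metis imageE)
  qed
  then show ?thesis by blast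
qed

text \<open>Step \<open>n\<close> adds the orbit with index \<open>m + n\<close> through the
  \<open>n\<close>-th point of a dense sequence. The partial maps cohere, every point is placed
  eventually, and invariance is inherited from the pseudometrics \<open>d n\<close>.\<close>

lemma dense_realization:
  fixes \<phi>0 :: "'g::{ab_group_add, countable} \<times> nat \<Rightarrow> 'u::metric_space"
  assumes U: "urysohn_space TYPE('u)" and st: "stage m d0 E0 \<phi>0"
  shows "\<exists>\<phi> :: 'g \<times> nat \<Rightarrow> 'u. (\<forall>x\<in>E0. \<phi> x = \<phi>0 x) \<and>
      (\<forall>x y. snd x < m \<longrightarrow> snd y < m \<longrightarrow> dist (\<phi> x) (\<phi> y) = d0 x y) \<and>
      (\<forall>c x y. dist (\<phi> (tr c x)) (\<phi> (tr c y)) = dist (\<phi> x) (\<phi> y)) \<and>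
      (\<forall>u \<epsilon>. 0 < \<epsilon> \<longrightarrow> (\<exists>x. dist (\<phi> x) u < \<epsilon>))"
proof -
  obtain b :: "nat \<Rightarrow> 'u" where b: "\<And>x \<epsilon>. 0 < \<epsilon> \<Longrightarrow> \<exists>n. dist (b n) x < \<epsilon>"
    using urysohn_dense_sequence[OF U] by blast
  \<comment> \<open>Countability of the group enters here: each \<open>B n\<close> is finite, and
    together they exhaust all points. The first condition keeps \<open>B n\<close> inside the orbits
    present after step \<open>n\<close>.\<close>
  define B where "B n = {x :: 'g \<times> nat. snd x < Suc (m + n) \<and> to_nat x \<le> n}" for n
  have B: "finite (B n)" for n
  proof -
    have "finite {x :: 'g \<times> nat. to_nat x \<in> {..n}}"
      using finite_vimageI[OF finite_atMost inj_to_nat, of n] by (simp add: vimage_def)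
    then show ?thesis by (rule rev_finite_subset) (auto simp: B_def)
  qed
  define R where "R n s s' \<longleftrightarrow>
     (\<forall>x y. snd x < m + n \<longrightarrow> snd y < m + n \<longrightarrow> fst s' x y = fst s x y) \<and>
     fst (snd s) \<union> B n \<subseteq> fst (snd s') \<and> (\<forall>x\<in>fst (snd s). snd (snd s') x = snd (snd s) x) \<and>
     b n \<in> snd (snd s') ` fst (snd s')"
    for n and s s' :: "('g \<times> nat \<Rightarrow> 'g \<times> nat \<Rightarrow> real) \<times> ('g \<times> nat) set \<times> ('g \<times> nat \<Rightarrow> 'u)"
  \<comment> \<open>The second conjunct pins the initial state, which dependent choice would
    otherwise leave free.\<close>
  let ?P = "\<lambda>n s. stage (m + n) (fst s) (fst (snd s)) (snd (snd s)) \<and> (n = 0 \<longrightarrow> s = (d0, E0, \<phi>0))"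
  have step: "\<exists>s'. ?P (Suc n) s' \<and> R n s s'" if "?P n s" for n s
  proof -
    obtain d E \<phi> where s: "s = (d, E, \<phi>)" by (metis prod_cases3)
    have "stage (m + n) d E \<phi>" using that s by simp
    from stage_step[OF U this B, of n "b n"] obtain d' E' \<phi>' where
      "stage (Suc (m + n)) d' E' \<phi>'"
      "\<forall>x y. snd x < m + n \<longrightarrow> snd y < m + n \<longrightarrow> d' x y = d x y"
      "E \<union> B n \<subseteq> E'" "\<forall>x\<in>E. \<phi>' x = \<phi> x" "b n \<in> \<phi>' ` E'"
      by (auto simp: B_def)
    then show ?thesis unfolding R_def s by (intro exI[of _ "(d', E', \<phi>')"]) auto
  qed
  have "?P 0 (d0, E0, \<phi>0)" using st by simp
  then obtain s where s: "\<And>n. ?P n (s n)" "\<And>n. R n (s n) (s (Suc n))"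
    using dependent_nat_choice[of ?P R] step by blast
  define d where "d n = fst (s n)" for n
  define E where "E n = fst (snd (s n))" for n
  define \<phi>s where "\<phi>s n = snd (snd (s n))" for n
  have st': "stage (m + n) (d n) (E n) (\<phi>s n)" for n using s(1) by (simp add: d_def E_def \<phi>s_def)
  have init: "d 0 = d0" "E 0 = E0" "\<phi>s 0 = \<phi>0" using s(1)[of 0] by (auto simp: d_def E_def \<phi>s_def)
  have R: "d (Suc n) x y = d n x y" if "snd x < m + n" "snd y < m + n" for n x y
    using s(2)[of n] that unfolding R_def d_def by blast
  have RE: "E n \<union> B n \<subseteq> E (Suc n)" and R\<phi>: "x \<in> E n \<Longrightarrow> \<phi>s (Suc n) x = \<phi>s n x"
    and Rb: "b n \<in> \<phi>s (Suc n) ` E (Suc n)" for n x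
    using s(2)[of n] by (auto simp: R_def E_def \<phi>s_def)
  have Emono: "E n \<subseteq> E k" if "n \<le> k" for n k
    by (rule lift_Suc_mono_le[OF _ that]) (use RE in blast)
  have \<phi>mono: "\<phi>s k x = \<phi>s n x" if "n \<le> k" "x \<in> E n" for n k x
    using that(1)
  proof (induction k rule: dec_induct)
    case (step k)
    then show ?case using R\<phi>[of x k] Emono[of n k] that(2) by auto
  qed simp
  have dmono: "d k x y = d n x y" if "n \<le> k" "snd x < m + n" "snd y < m + n" for n k x y
    using that(1)
  proof (induction k rule: dec_induct)
    case (step k)
    then show ?case using R[of x k y] that by auto
  qed simp
  have ex: "\<exists>n. x \<in> E n" for x
  proof -
    have "x \<in> B (max (snd x) (to_nat x))" by (auto simp: B_def)
    then show ?thesis using RE by blast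
  qed
  define N where "N x = (LEAST n. x \<in> E n)" for x
  define \<phi> where "\<phi> x = \<phi>s (N x) x" for x
  have N: "x \<in> E (N x)" for x unfolding N_def using ex by (rule LeastI_ex)
  have \<phi>_eq: "\<phi> x = \<phi>s n x" if "x \<in> E n" for n x
    using \<phi>mono[OF _ N, of x n] that unfolding \<phi>_def N_def by (simp add: Least_le)
  have dist_eq: "dist (\<phi> x) (\<phi> y) = d n x y" if "x \<in> E n" "y \<in> E n" for n x y
    using st'[of n] that by (auto simp: stage_def realizes_def \<phi>_eq)
  have large: "\<exists>n. x \<in> E n \<and> y \<in> E n \<and> tr c x \<in> E n \<and> tr c y \<in> E n" for c x y
  proof -
    have "z \<in> E k" if "N z \<le> k" for z k using N Emono[OF that] by blast
    then show ?thesis by (intro exI[of _ "N x + N y + N (tr c x) + N (tr c y)"]) simp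
  qed
  have "\<forall>x\<in>E0. \<phi> x = \<phi>0 x" using \<phi>_eq[of _ 0] init by auto
  moreover have "dist (\<phi> x) (\<phi> y) = d0 x y" if "snd x < m" "snd y < m" for x y
  proof -
    obtain n where "x \<in> E n" "y \<in> E n" using large by blast
    then show ?thesis using dist_eq dmono[of 0 n x y] that init by auto
  qed
  moreover have "dist (\<phi> (tr c x)) (\<phi> (tr c y)) = dist (\<phi> x) (\<phi> y)" for c x y
  proof -
    obtain n where n: "x \<in> E n" "y \<in> E n" "tr c x \<in> E n" "tr c y \<in> E n" using large by blast
    interpret inv_pmetric "m + n" "d n" using st' by (simp add: stage_def)
    have "snd x < m + n" "snd y < m + n" using st'[of n] n by (auto simp: stage_def)
    then show ?thesis using dist_eq n inv by simp
  qed
  moreover have "\<exists>x. dist (\<phi> x) u < \<epsilon>" if \<epsilon>: "0 < \<epsilon>" for u \<epsilon>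
  proof -
    obtain n where n: "dist (b n) u < \<epsilon>" using b[OF \<epsilon>] by blast
    obtain x where "x \<in> E (Suc n)" "b n = \<phi>s (Suc n) x" using Rb by blast
    then have "\<phi> x = b n" using \<phi>_eq by simp
    then show ?thesis using n by metis
  qed
  ultimately show ?thesis by blast
qed

text \<open>Translation by \<open>c\<close> is an isometry of a dense set, so it extends to the
  complete space. A point is determined by its distances to the dense family, which reduces the
  homomorphism law to a comparison of distances.\<close>

lemma action_from_dense_family:
  fixes \<phi> :: "'g::ab_group_add \<times> nat \<Rightarrow> 'u::metric_space"
  assumes U: "complete (UNIV :: 'u set)"
    and inv: "\<And>c x y. dist (\<phi> (tr c x)) (\<phi> (tr c y)) = dist (\<phi> x) (\<phi> y)"
    and dense: "\<And>u \<epsilon>. 0 < \<epsilon> \<Longrightarrow> \<exists>x. dist (\<phi> x) u < \<epsilon>"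
  shows "\<exists>\<rho>\<in>Hom_Iso. \<forall>c x. \<rho> c (\<phi> x) = \<phi> (tr c x)"
proof -
  have uniq: "v = w" if "\<And>x. dist v (\<phi> x) = dist w (\<phi> x)" for v w
  proof (rule ccontr)
    assume "v \<noteq> w"
    then obtain x where x: "dist (\<phi> x) v < dist v w / 2" using dense[of "dist v w / 2" v] by auto
    then show False using that[of x] dist_triangle[of v w "\<phi> x"] by (simp add: dist_commute)
  qed
  have ex: "\<exists>v. \<forall>x. dist v (\<phi> (tr c x)) = dist u (\<phi> x)" for c u
  proof -
    have "\<forall>n. \<exists>x. dist (\<phi> x) u < inverse (real (Suc n))" using dense by simp
    then obtain X where X: "\<And>n. dist (\<phi> (X n)) u < inverse (real (Suc n))" by metis
    then have lim: "(\<lambda>n. \<phi> (X n)) \<longlonglongrightarrow> u"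
      by (intro metric_tendsto_imp_tendsto[OF LIMSEQ_inverse_real_of_nat])
        (auto intro!: always_eventually less_imp_le)
    then have "Cauchy (\<lambda>n. \<phi> (X n))" by (rule LIMSEQ_imp_Cauchy)
    then have "Cauchy (\<lambda>n. \<phi> (tr c (X n)))" unfolding Cauchy_def by (simp add: inv)
    then obtain v where v: "(\<lambda>n. \<phi> (tr c (X n))) \<longlonglongrightarrow> v" using U unfolding complete_def by auto
    have "dist v (\<phi> (tr c x)) = dist u (\<phi> x)" for x
    proof (rule LIMSEQ_unique)
      show "(\<lambda>n. dist (\<phi> (tr c (X n))) (\<phi> (tr c x))) \<longlonglongrightarrow> dist v (\<phi> (tr c x))"
        by (intro tendsto_intros v)
      show "(\<lambda>n. dist (\<phi> (tr c (X n))) (\<phi> (tr c x))) \<longlonglongrightarrow> dist u (\<phi> x)"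
        unfolding inv by (intro tendsto_intros lim)
    qed
    then show ?thesis by blast
  qed
  \<comment> \<open>Describing the image by its distances rather than as a limit makes it
    independent of the approximating sequence.\<close>
  define \<rho> where "\<rho> c u = (SOME v. \<forall>x. dist v (\<phi> (tr c x)) = dist u (\<phi> x))" for c u
  have \<rho>: "dist (\<rho> c u) (\<phi> (tr c x)) = dist u (\<phi> x)" for c u x
    using someI_ex[OF ex[of c u]] unfolding \<rho>_def by blast
  have \<rho>': "dist (\<rho> c u) (\<phi> x) = dist u (\<phi> (tr (- c) x))" for c u x
    using \<rho>[of c u "tr (- c) x"] by simp
  have \<rho>\<phi>: "\<rho> c (\<phi> x) = \<phi> (tr c x)" for c x
    using \<rho>[of c "\<phi> x" x] by simp
  have add: "\<rho> (a + b) = \<rho> a \<circ> \<rho> b" for a b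
  proof
    show "\<rho> (a + b) u = (\<rho> a \<circ> \<rho> b) u" for u
      by (rule uniq) (simp add: \<rho>' algebra_simps)
  qed
  have 0: "\<rho> 0 = id"
  proof
    show "\<rho> 0 u = id u" for u by (rule uniq) (simp add: \<rho>')
  qed
  have iso: "dist (\<rho> c u) (\<rho> c v) = dist u v" for c u v
  proof -
    have "\<bar>dist (\<rho> c u) (\<rho> c v) - dist u v\<bar> \<le> 2 * \<epsilon>" if \<epsilon>: "0 < \<epsilon>" for \<epsilon>
    proof -
      obtain x where x: "dist (\<phi> x) u < \<epsilon>" using dense \<epsilon> by blast
      have "dist u (\<phi> x) = dist (\<rho> c u) (\<phi> (tr c x))" "dist v (\<phi> x) = dist (\<rho> c v) (\<phi> (tr c x))"
        by (simp_all add: \<rho>)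
      then show ?thesis using x
        by (smt (verit) dist_commute dist_triangle)
    qed
    from this[of "\<bar>dist (\<rho> c u) (\<rho> c v) - dist u v\<bar> / 4"] show ?thesis by auto
  qed
  have "bij (\<rho> c)" for c
    using add[of c "- c"] add[of "- c" c] 0 by (intro o_bij[of "\<rho> (- c)"]) auto
  then have "\<rho> \<in> Hom_Iso" using iso add by (auto simp: Hom_Iso_def Iso_def)
  then show ?thesis using \<rho>\<phi> by blast
qed

section \<open>Multiples and truncated word length\<close>

text \<open>The iterate is the one that occurs in \<open>torsion_free\<close>.\<close>

definition multiple :: "nat \<Rightarrow> 'g::ab_group_add \<Rightarrow> 'g" where
  "multiple n x = ((+) x ^^ n) 0"

lemma multiple_0 [simp]: "multiple 0 x = 0"
  and multiple_Suc [simp]: "multiple (Suc n) x = x + multiple n x"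
  by (simp_all add: multiple_def)

lemma multiple_add: "multiple (p + q) x = multiple p x + multiple q x"
  by (induction p) (simp_all add: add.assoc)

lemma multiple_mult: "multiple (p * q) x = multiple p (multiple q x)"
  by (induction p) (simp_all add: multiple_add)

lemma inj_multiple:
  assumes "torsion_free TYPE('g::ab_group_add)" and "(x::'g) \<noteq> 0"
  shows "inj (\<lambda>n. multiple n x)"
proof -
  have tf: "n > 0 \<and> multiple n x = 0 \<longrightarrow> x = 0" for n
    using assms(1) unfolding torsion_free_def multiple_def by (elim allE)
  have le: "q \<le> p" if "multiple p x = multiple q x" for p q
  proof (rule ccontr)
    assume "\<not> q \<le> p"
    then have "multiple (q - p) x = 0" "q - p > 0"
      using that multiple_add[of p "q - p" x] by simp_all
    then show False using tf[of "q - p"] \<open>x \<noteq> 0\<close> by simp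
  qed
  show ?thesis
  proof (rule injI)
    fix p q assume "multiple p x = multiple q x"
    then show "p = q" using le[of p q] le[of q p] by simp
  qed
qed

definition additive_subgroup :: "'g::ab_group_add set \<Rightarrow> bool" where
  "additive_subgroup N \<longleftrightarrow> 0 \<in> N \<and> (\<forall>a\<in>N. \<forall>b\<in>N. a + b \<in> N) \<and> (\<forall>a\<in>N. - a \<in> N)"

lemma additive_subgroupD:
  assumes "additive_subgroup N"
  shows "0 \<in> N" "a \<in> N \<Longrightarrow> b \<in> N \<Longrightarrow> a + b \<in> N" "a \<in> N \<Longrightarrow> - a \<in> N"
  using assms unfolding additive_subgroup_def by blast+

text \<open>The cyclic subgroup generated by \<open>y\<close>; differences of natural multiples
  stand for integer multiples.\<close>

definition multiples :: "'g::ab_group_add \<Rightarrow> 'g set" where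
  "multiples y = {multiple p y - multiple q y | p q. True}"

lemma additive_subgroup_multiples: "additive_subgroup (multiples y)"
  unfolding additive_subgroup_def
proof (intro conjI ballI)
  have "0 = multiple 0 y - multiple 0 y" by simp
  then show "0 \<in> multiples y" unfolding multiples_def by blast
next
  fix a b assume "a \<in> multiples y" "b \<in> multiples y"
  then obtain p q p' q' where "a = multiple p y - multiple q y" "b = multiple p' y - multiple q' y"
    unfolding multiples_def by auto
  then have "a + b = multiple (p + p') y - multiple (q + q') y"
    by (simp add: multiple_add)
  then show "a + b \<in> multiples y" unfolding multiples_def by blast
next
  fix a assume "a \<in> multiples y"
  then obtain p q where "a = multiple p y - multiple q y" unfolding multiples_def by auto
  then have "- a = multiple q y - multiple p y" by simp
  then show "- a \<in> multiples y" unfolding multiples_def by blast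
qed

lemma self_in_multiples: "y \<in> multiples y"
proof -
  have "y = multiple 1 y - multiple 0 y" by simp
  then show ?thesis unfolding multiples_def by blast
qed

lemma multiples_cases:
  assumes "c \<in> multiples y"
  obtains k where "c = multiple k y" | k where "c = - multiple k y"
proof -
  obtain p q where c: "c = multiple p y - multiple q y"
    using assms unfolding multiples_def by auto
  show ?thesis
  proof (cases "q \<le> p")
    case True
    then have "c = multiple (p - q) y" using multiple_add[of q "p - q" y] c by simp
    then show ?thesis using that by blast
  next
    case False
    then have "c = - multiple (q - p) y" using multiple_add[of p "q - p" y] c by simp
    then show ?thesis using that by blast
  qed
qed

text \<open>By torsion-freeness only finitely many natural multiples of \<open>x\<close> lie in
  \<open>B\<close> or \<open>- B\<close>. If \<open>n\<close> exceeds all their indices, then a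
  non-zero element of the subgroup is, up to sign, a multiple of \<open>x\<close> of index at least
  \<open>n\<close>, hence outside \<open>B\<close>.\<close>

lemma multiples_avoid_finite:
  fixes x :: "'g::ab_group_add"
  assumes "torsion_free TYPE('g)" and "x \<noteq> 0" and "finite B" and "infinite S"
  shows "\<exists>n\<in>S. multiples (multiple n x) \<inter> B \<subseteq> {0}"
proof -
  let ?J = "{j. multiple j x \<in> B \<union> uminus ` B}"
  have "finite ?J"
    using finite_vimageI[OF _ inj_multiple[OF assms(1,2)], of "B \<union> uminus ` B"] \<open>finite B\<close>
    by (simp add: vimage_def)
  then obtain b where b: "\<And>j. j \<in> ?J \<Longrightarrow> j < b"
    unfolding finite_nat_set_iff_bounded by blast
  obtain n where n: "n \<in> S" "b \<le> n"
    using \<open>infinite S\<close> unfolding infinite_nat_iff_unbounded_le by blast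
  have "c = 0" if c: "c \<in> multiples (multiple n x)" "c \<in> B" for c
  proof -
    obtain k where k: "c = multiple (k * n) x \<or> c = - multiple (k * n) x"
      using multiples_cases[OF c(1)] by (metis multiple_mult)
    then have "k * n \<in> ?J" using c(2) by (force simp: image_iff)
    then have "k * n < n" using b[of "k * n"] n(2) by linarith
    then have "k = 0" by (cases k) auto
    then show ?thesis using k by auto
  qed
  then show ?thesis using n by blast
qed

section \<open>Finite sumsets and truncated word length\<close>

fun sumset_power :: "'g::ab_group_add set \<Rightarrow> nat \<Rightarrow> 'g set" where
  "sumset_power T 0 = {0}"
| "sumset_power T (Suc n) = (\<lambda>(a, b). a + b) ` (T \<times> sumset_power T n)"

lemma sumset_power_add:
  "a \<in> sumset_power T p \<Longrightarrow> b \<in> sumset_power T q \<Longrightarrow> a + b \<in> sumset_power T (p + q)"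
proof (induction p arbitrary: a)
  case (Suc p)
  then obtain t a' where "t \<in> T" "a' \<in> sumset_power T p" "a = t + a'" by auto
  with Suc show ?case by (auto simp: add.assoc image_iff intro!: bexI[of _ "(t, a' + b)"])
qed simp

lemma sumset_power_uminus:
  assumes "uminus ` T \<subseteq> T"
  shows "a \<in> sumset_power T p \<Longrightarrow> - a \<in> sumset_power T p"
proof (induction p arbitrary: a)
  case (Suc p)
  then obtain t a' where "t \<in> T" "a' \<in> sumset_power T p" "a = t + a'" by auto
  then have "(- t, - a') \<in> T \<times> sumset_power T p" "- a = - t + - a'"
    using Suc.IH assms by auto
  then show ?case unfolding sumset_power.simps by (metis (no_types, lifting) case_prod_conv image_eqI)
qed simp

lemma finite_sumset_power: "finite T \<Longrightarrow> finite (sumset_power T n)"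
  by (induction n) auto

text \<open>Finiteness is asked only of the elements of length below \<open>K\<close>, so that such
  lengths exist for a finite \<open>T\<close> that need not generate the group.\<close>

definition truncated_length :: "'g::ab_group_add set \<Rightarrow> nat \<Rightarrow> ('g \<Rightarrow> nat) \<Rightarrow> bool" where
  "truncated_length T K l \<longleftrightarrow> l 0 = 0 \<and> (\<forall>g. l (- g) = l g) \<and> (\<forall>g h. l (g + h) \<le> l g + l h) \<and>
    (\<forall>g. g \<noteq> 0 \<longrightarrow> 1 \<le> l g) \<and> (\<forall>t\<in>T. l t \<le> 1) \<and> finite {g. l g < K}"

text \<open>Word length with respect to \<open>T\<close> and its negatives, cut off at
  \<open>K\<close>, is symmetric and remains subadditive; fewer than \<open>K\<close> letters from a
  finite alphabet give finitely many words.\<close>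

lemma truncated_length_exists:
  fixes T :: "'g::ab_group_add set"
  assumes "finite T" "0 < K"
  shows "\<exists>l. truncated_length T K l"
proof -
  define T' where "T' = T \<union> uminus ` T"
  define W where "W = sumset_power T'"
  \<comment> \<open>The alternative \<open>n = K\<close> performs the truncation and also gives a
    value to elements that are not words in \<open>T'\<close>.\<close>
  define l where "l g = (LEAST n. n = K \<or> g \<in> W n)" for g
  have l_K: "l g \<le> K" for g unfolding l_def by (rule Least_le) simp
  have l_W: "l g \<le> n" if "g \<in> W n" for g n unfolding l_def using that by (intro Least_le) simp
  have W_l: "g \<in> W (l g)" if "l g < K" for g
  proof -
    have "l g = K \<or> g \<in> W (l g)" unfolding l_def by (rule LeastI[of _ K]) simp
    then show ?thesis using that by simp
  qed
  have T': "uminus ` T' \<subseteq> T'" by (auto simp: T'_def)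
  have "l (- g) \<le> l g" for g
  proof (cases "l g < K")
    case True
    then show ?thesis using l_W sumset_power_uminus[OF T'] W_l[of g] unfolding W_def by blast
  next
    case False
    then show ?thesis using l_K[of "- g"] by simp
  qed
  from this this[of "- g" for g] have "l (- g) = l g" for g
    by (metis add.inverse_inverse antisym)
  moreover have "l 0 = 0" using l_W[of 0 0] by (simp add: W_def)
  moreover have "l (g + h) \<le> l g + l h" for g h
  proof (cases "l g < K \<and> l h < K")
    case True
    then show ?thesis using l_W sumset_power_add W_l[of g] W_l[of h] unfolding W_def by blast
  next
    case False
    then show ?thesis using l_K[of "g + h"] by auto
  qed
  moreover have "1 \<le> l g" if "g \<noteq> 0" for g
    using W_l[of g] that \<open>0 < K\<close> by (cases "l g = 0") (auto simp: W_def)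
  moreover have "l t \<le> 1" if "t \<in> T" for t
    using that by (intro l_W) (auto simp: W_def T'_def image_iff intro!: bexI[of _ "(t, 0)"])
  moreover have "finite {g. l g < K}"
  proof (rule finite_subset)
    show "{g. l g < K} \<subseteq> (\<Union>n<K. W n)" using W_l by auto
    show "finite (\<Union>n<K. W n)"
      using assms finite_sumset_power[of T'] by (auto simp: W_def T'_def)
  qed
  ultimately show ?thesis by (auto simp: truncated_length_def)
qed

section \<open>Approximation by actions that are trivial on a subgroup\<close>

lemma Hom_Iso_props:
  assumes "\<rho> \<in> Hom_Iso"
  shows "\<rho> (a + b) u = \<rho> a (\<rho> b u)" "\<rho> 0 u = u" "dist (\<rho> c u) (\<rho> c v) = dist u v"
proof -
  have add: "\<rho> (a + b) u = \<rho> a (\<rho> b u)" for a b u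
    using assms by (auto simp: Hom_Iso_def)
  show iso: "dist (\<rho> c u) (\<rho> c v) = dist u v" for c u v
    using assms by (auto simp: Hom_Iso_def Iso_def)
  \<comment> \<open>\<open>\<rho> 0\<close> is an idempotent isometry, so it moves no point.\<close>
  show "\<rho> 0 u = u" using add[of 0 0 u] iso[of 0 "\<rho> 0 u" u] by simp
  show "\<rho> (a + b) u = \<rho> a (\<rho> b u)" by (rule add)
qed

text \<open>The infimum is the distance from the \<open>N\<close>-orbit of \<open>x\<close> to
  \<open>y\<close>. It stays invariant because translations of an abelian group commute.\<close>

lemma inv_pmetric_quotient:
  assumes "inv_pmetric m d" and sub: "additive_subgroup N"
  shows "inv_pmetric m (\<lambda>x y. INF c\<in>N. d (tr c x) y)"
proof -
  note N0 = additive_subgroupD(1)[OF sub] and Nadd = additive_subgroupD(2)[OF sub]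
    and Nminus = additive_subgroupD(3)[OF sub]
  interpret inv_pmetric m d by fact
  have lower: "(INF c\<in>N. d (tr c x) y) \<le> d (tr c x) y" if "c \<in> N" "snd x < m" "snd y < m" for c x y
    using that nonneg by (intro INF_lower_real) auto
  have N: "N \<noteq> {}" using N0 by auto
  have swap: "d (tr (- c) y) x = d (tr c x) y" if "snd x < m" "snd y < m" for c x y
    using inv[of "tr (- c) y" x c] sym[of y "tr c x"] that by simp
  have half: "(INF c\<in>N. d (tr c x) y) \<le> (INF c\<in>N. d (tr c y) x)" if "snd x < m" "snd y < m" for x y
  proof (rule cINF_greatest[OF N])
    fix c assume "c \<in> N"
    with lower[of "- c" x y] swap[of y x c] Nminus that
    show "(INF c\<in>N. d (tr c x) y) \<le> d (tr c y) x" by simp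
  qed
  show ?thesis
  proof
    fix x y z :: "'a \<times> nat" assume x: "snd x < m" and y: "snd y < m" and z: "snd z < m"
    show "(INF c\<in>N. d (tr c x) x) = 0"
    proof (rule antisym)
      show "(INF c\<in>N. d (tr c x) x) \<le> 0" using lower[OF N0 x x] zero[OF x] by simp
      show "0 \<le> (INF c\<in>N. d (tr c x) x)" using nonneg x by (intro cINF_greatest[OF N]) simp
    qed
    show "(INF c\<in>N. d (tr c x) y) = (INF c\<in>N. d (tr c y) x)"
      using half x y by (intro antisym)
    \<comment> \<open>Translating the first leg by \<open>b\<close> makes it end where the second
      leg starts.\<close>
    have le: "(INF c\<in>N. d (tr c x) z) \<le> d (tr a x) y + d (tr b y) z" if "a \<in> N" "b \<in> N" for a b
      using lower[OF Nadd[OF that(2,1)] x z] tri[of "tr (b + a) x" "tr b y" z] x y z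
        inv[of "tr a x" y b] by simp
    have "(INF c\<in>N. d (tr c x) z) - d (tr a x) y \<le> (INF c\<in>N. d (tr c y) z)" if "a \<in> N" for a
      using le[OF that] by (intro cINF_greatest[OF N]) (simp add: algebra_simps)
    then have "(INF c\<in>N. d (tr c x) z) - (INF c\<in>N. d (tr c y) z) \<le> (INF c\<in>N. d (tr c x) y)"
      by (intro cINF_greatest[OF N]) (simp add: algebra_simps)
    then show "(INF c\<in>N. d (tr c x) z) \<le> (INF c\<in>N. d (tr c x) y) + (INF c\<in>N. d (tr c y) z)"
      by simp
    show "(INF c\<in>N. d (tr c (tr g x)) (tr g y)) = (INF c\<in>N. d (tr c x) y)" for g
    proof -
      have "d (tr c (tr g x)) (tr g y) = d (tr c x) y" for c
        using inv[of "tr c x" y g] x y by (simp add: add.commute)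
      then show ?thesis by simp
    qed
  qed
qed

lemma inv_pmetric_add_length:
  assumes \<rho>: "\<rho> \<in> Hom_Iso" and "0 \<le> M" "0 \<le> \<eta>"
    and l: "l 0 = 0" "\<And>g. l (- g) = l g" "\<And>g h. l (g + h) \<le> l g + l h"
  shows "inv_pmetric m (\<lambda>x y. min M (dist (\<rho> (fst x) (a (snd x))) (\<rho> (fst y) (a (snd y))) +
    \<eta> * real (l (fst x - fst y))))" (is "inv_pmetric m ?d")
proof
  fix x y z :: "'a \<times> nat"
  show "?d x x = 0" using assms by simp
  show "?d x y = ?d y x" using l(2)[of "fst x - fst y"] by (simp add: dist_commute)
  have "real (l (fst x - fst z)) \<le> real (l (fst x - fst y)) + real (l (fst y - fst z))"
    using l(3)[of "fst x - fst y" "fst y - fst z"] by simp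
  then have "\<eta> * real (l (fst x - fst z)) \<le> \<eta> * real (l (fst x - fst y)) + \<eta> * real (l (fst y - fst z))"
    using \<open>0 \<le> \<eta>\<close> by (simp add: mult_left_mono flip: distrib_left)
  moreover have "0 \<le> \<eta> * real (l g)" for g using \<open>0 \<le> \<eta>\<close> by simp
  ultimately show "?d x z \<le> ?d x y + ?d y z"
    using \<open>0 \<le> M\<close> dist_triangle[of "\<rho> (fst x) (a (snd x))" "\<rho> (fst z) (a (snd z))" "\<rho> (fst y) (a (snd y))"]
    by (smt (verit) zero_le_dist)
  show "?d (tr c x) (tr c y) = ?d x y" for c
    using Hom_Iso_props[OF \<rho>] by simp
qed

text \<open>Adding a small multiple of a word length to the orbit pseudometric of \<open>\<rho>\<close> and truncating
pushes all but finitely many translates to the maximal distance. Passing to the quotient by \<open>N\<close>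
then leaves the distances over \<open>F\<close> unchanged.\<close>

lemma subgroup_trivial_approximation:
  fixes \<rho> :: "'g::{ab_group_add, countable} \<Rightarrow> ('u::metric_space \<Rightarrow> 'u)"
  assumes U: "urysohn_space TYPE('u)" and \<rho>: "\<rho> \<in> Hom_Iso"
    and F: "finite F" and A: "finite A" "A \<noteq> {}" and "0 < \<epsilon>"
  shows "\<exists>B. finite B \<and> (\<forall>N. additive_subgroup N \<longrightarrow> N \<inter> B \<subseteq> {0} \<longrightarrow>
     (\<exists>\<sigma>\<in>Hom_Iso. (\<forall>f\<in>F. \<forall>a\<in>A. dist (\<sigma> f a) (\<rho> f a) < \<epsilon>) \<and>
        (\<forall>c\<in>N. \<forall>a\<in>A. dist (\<sigma> c a) a < \<epsilon>) \<and> (\<forall>g. g \<notin> N \<longrightarrow> (\<exists>u. \<sigma> g u \<noteq> u))))"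
proof -
  obtain m :: nat and a where a: "A = a ` {i. i < m}"
    using finite_imp_nat_seg_image_inj_on[OF A(1)] by auto
  have m: "0 < m" using A(2) a by auto
  \<comment> \<open>Including 0 forces the base points \<open>(0, i)\<close> to be placed close to
    \<open>a i\<close>.\<close>
  define F1 where "F1 = insert 0 F"
  define E where "E = F1 \<times> {..<m}"
  define T where "T = (\<lambda>(f, f'). f - f') ` (F1 \<times> F1)"
  have finE: "finite E" and finT: "finite T" using F by (simp_all add: E_def T_def F1_def)
  have "E \<noteq> {}" using m by (auto simp: E_def F1_def)
  then have card: "0 < card E" using finE by (simp add: card_gt_0_iff)
  \<comment> \<open>The perturbation then displaces points by at most \<open>\<epsilon> / 3\<close>,
    and each final estimate adds two such errors.\<close>
  define \<eta> where "\<eta> = \<epsilon> / (3 * real (card E))"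
  have \<eta>: "0 < \<eta>" "real (card E) * \<eta> = \<epsilon> / 3" using \<open>0 < \<epsilon>\<close> card by (simp_all add: \<eta>_def)
  define \<psi> where "\<psi> x = \<rho> (fst x) (a (snd x))" for x
  \<comment> \<open>Truncating at \<open>M\<close> does not cut distances over \<open>E\<close>
    short; the added \<open>\<eta>\<close> keeps \<open>M\<close> positive even if all of them
    vanish.\<close>
  define M where "M = Max ((\<lambda>(x, y). dist (\<psi> x) (\<psi> y)) ` (E \<times> E)) + \<eta>"
  have M: "dist (\<psi> x) (\<psi> y) + \<eta> \<le> M" if "x \<in> E" "y \<in> E" for x y
  proof -
    have "(case (x, y) of (x, y) \<Rightarrow> dist (\<psi> x) (\<psi> y)) \<le> Max ((\<lambda>(x, y). dist (\<psi> x) (\<psi> y)) ` (E \<times> E))"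
      by (rule Max_ge[OF _ imageI]) (use that finE in auto)
    then show ?thesis by (simp add: M_def)
  qed
  obtain e0 where "e0 \<in> E" using \<open>E \<noteq> {}\<close> by auto
  then have M0: "0 < M" using M[of e0 e0] \<eta> by simp
  \<comment> \<open>A length of at least \<open>K\<close> alone already pushes the distance up to
    \<open>M\<close>.\<close>
  obtain K :: nat where K: "M < real K * \<eta>" using ex_less_of_nat_mult[OF \<eta>(1)] by blast
  then have "0 < K" using M0 by (cases K) auto
  obtain l where "truncated_length T K l"
    using truncated_length_exists[OF finT \<open>0 < K\<close>] by blast
  then have l: "l 0 = 0" "\<And>g. l (- g) = l g" "\<And>g h. l (g + h) \<le> l g + l h"
    "\<And>g. g \<noteq> 0 \<Longrightarrow> 1 \<le> l g" "\<And>t. t \<in> T \<Longrightarrow> l t \<le> 1" "finite {g. l g < K}"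
    by (simp_all add: truncated_length_def)
  \<comment> \<open>These are the elements \<open>c\<close> for which \<open>c + t\<close> is short
    for some difference \<open>t\<close> of \<open>F1\<close>.\<close>
  define B where "B = (\<lambda>(g, t). g - t) ` ({g. l g < K} \<times> T)"
  have finB: "finite B" using l(6) finT by (simp add: B_def)
  have far: "K \<le> l (c + t)" if "c \<notin> B" "t \<in> T" for c t
  proof (rule ccontr)
    assume "\<not> K \<le> l (c + t)"
    then have "c \<in> B" using that(2) unfolding B_def
      by (intro image_eqI[of _ _ "(c + t, t)"]) auto
    then show False using that by simp
  qed
  define d1 where "d1 x y = min M (dist (\<psi> x) (\<psi> y) + \<eta> * real (l (fst x - fst y)))" for x y
  have d1: "inv_pmetric m d1"
    using inv_pmetric_add_length[OF \<rho>, of M \<eta> l m a] M0 \<eta> l(1-3)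
    unfolding d1_def \<psi>_def by simp
  show ?thesis
  proof (intro exI[of _ B] conjI finB allI impI)
    fix N :: "'g set"
    assume N: "additive_subgroup N" and NB: "N \<inter> B \<subseteq> {0}"
    note N0 = additive_subgroupD(1)[OF N] and Nminus = additive_subgroupD(3)[OF N]
    define d where "d x y = (INF c\<in>N. d1 (tr c x) y)" for x y
    have d: "inv_pmetric m d"
      unfolding d_def using d1 N by (rule inv_pmetric_quotient)
    have d_le: "d x y \<le> d1 (tr c x) y" if "c \<in> N" "snd x < m" "snd y < m" for c x y
      unfolding d_def using that inv_pmetric.nonneg[OF d1] by (intro INF_lower_real) auto
    have d_ge: "r \<le> d x y" if "\<And>c. c \<in> N \<Longrightarrow> r \<le> d1 (tr c x) y" for r x y
      unfolding d_def using that N0 by (intro cINF_greatest) auto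
    \<comment> \<open>The upper bound takes \<open>c = 0\<close>, where the length term is at most
      \<open>\<eta>\<close>. For the lower bound, each non-zero \<open>c\<close> in \<open>N\<close>
      avoids \<open>B\<close> and yields the maximal value \<open>M\<close>.\<close>
    have "\<bar>d x y - dist (\<psi> x) (\<psi> y)\<bar> \<le> \<eta>" if x: "x \<in> E" and y: "y \<in> E" for x y
    proof -
      have t: "fst x - fst y \<in> T"
        unfolding T_def by (rule image_eqI[of _ _ "(fst x, fst y)"]) (use x y in \<open>auto simp: E_def\<close>)
      have "snd x < m" "snd y < m" using x y by (auto simp: E_def)
      from d_le[OF N0 this] have "d x y \<le> d1 x y" by simp
      also have "\<dots> \<le> dist (\<psi> x) (\<psi> y) + \<eta> * real (l (fst x - fst y))" by (simp add: d1_def)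
      also have "\<dots> \<le> dist (\<psi> x) (\<psi> y) + \<eta>"
        using mult_left_mono[of "real (l (fst x - fst y))" 1 \<eta>] l(5)[OF t] \<eta> by simp
      finally have "d x y \<le> dist (\<psi> x) (\<psi> y) + \<eta>" .
      moreover have "dist (\<psi> x) (\<psi> y) \<le> d x y"
      proof (rule d_ge)
        fix c assume c: "c \<in> N"
        show "dist (\<psi> x) (\<psi> y) \<le> d1 (tr c x) y"
        proof (cases "c = 0")
          case True
          then show ?thesis using M[OF x y] \<eta> by (simp add: d1_def)
        next
          case False
          then have "c \<notin> B" using c NB by blast
          then have "K \<le> l (c + (fst x - fst y))" using t by (rule far)
          then have "K \<le> l (c + fst x - fst y)" by (simp add: add_diff_eq)
          then have "real K * \<eta> \<le> \<eta> * real (l (c + fst x - fst y))"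
            using \<eta> by (simp add: mult.commute)
          then have "M \<le> dist (\<psi> (tr c x)) (\<psi> y) + \<eta> * real (l (c + fst x - fst y))"
            using K zero_le_dist[of "\<psi> (tr c x)" "\<psi> y"] by linarith
          then have "d1 (tr c x) y = M" by (simp add: d1_def)
          then show ?thesis using M[OF x y] \<eta> by simp
        qed
      qed
      ultimately show ?thesis by simp
    qed
    then obtain \<phi>0 where \<phi>0: "realizes E d \<phi>0" "\<And>x. x \<in> E \<Longrightarrow> dist (\<phi>0 x) (\<psi> x) \<le> \<epsilon> / 3"
      using urysohn_perturbation[OF U d _ finE, of \<eta> \<psi>] \<eta> by (auto simp: E_def)
    have "stage m d E \<phi>0" using d finE \<open>E \<noteq> {}\<close> \<phi>0 by (auto simp: stage_def E_def)
    from dense_realization[OF U this] obtain \<phi> :: "'g \<times> nat \<Rightarrow> 'u" where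
      \<phi>: "\<forall>x\<in>E. \<phi> x = \<phi>0 x" "\<And>x y. snd x < m \<Longrightarrow> snd y < m \<Longrightarrow> dist (\<phi> x) (\<phi> y) = d x y"
      "\<And>c x y. dist (\<phi> (tr c x)) (\<phi> (tr c y)) = dist (\<phi> x) (\<phi> y)"
      "\<And>u \<epsilon>. 0 < \<epsilon> \<Longrightarrow> \<exists>x. dist (\<phi> x) u < \<epsilon>" by blast
    obtain \<sigma> where \<sigma>: "\<sigma> \<in> Hom_Iso" "\<And>c x. \<sigma> c (\<phi> x) = \<phi> (tr c x)"
      using action_from_dense_family[of \<phi>, OF _ \<phi>(3,4)] U unfolding urysohn_space_def by blast
    have \<sigma>0: "\<sigma> c (\<phi> (0, i)) = \<phi> (c, i)" for c i using \<sigma>(2)[of c "(0, i)"] by (simp add: tr_def)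
    have near: "dist (\<phi> (f, i)) (\<rho> f (a i)) \<le> \<epsilon> / 3" if "f \<in> F1" "i < m" for f i
      using \<phi>0(2)[of "(f, i)"] \<phi>(1) that by (auto simp: E_def \<psi>_def)
    have near0: "dist (\<phi> (0, i)) (a i) \<le> \<epsilon> / 3" if "i < m" for i
      using near[of 0 i] that Hom_Iso_props(2)[OF \<rho>] by (simp add: F1_def)
    have moved: "dist (\<sigma> c (a i)) (\<phi> (c, i)) \<le> \<epsilon> / 3" if "i < m" for c i
      using Hom_Iso_props(3)[OF \<sigma>(1), of c "a i" "\<phi> (0, i)"] near0[OF that] \<sigma>0[of c i]
      by (simp add: dist_commute)
    have "dist (\<sigma> f (a i)) (\<rho> f (a i)) < \<epsilon>" if "f \<in> F" "i < m" for f i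
      using near[of f i] moved[of i f] dist_triangle[of "\<sigma> f (a i)" "\<rho> f (a i)" "\<phi> (f, i)"] that \<open>0 < \<epsilon>\<close>
      by (simp add: F1_def)
    moreover have "dist (\<sigma> c (a i)) (a i) < \<epsilon>" if "c \<in> N" "i < m" for c i
    proof -
      \<comment> \<open>\<open>(c, i)\<close> and \<open>(0, i)\<close> lie in one
        \<open>N\<close>-orbit, so the quotient pseudometric identifies them.\<close>
      have "d (c, i) (0, i) \<le> d1 (tr (- c) (c, i)) (0, i)"
        using d_le Nminus that by auto
      also have "\<dots> = 0" using inv_pmetric.zero[OF d1, of "(0, i)"] that by (simp add: tr_def)
      finally have "dist (\<phi> (c, i)) (\<phi> (0, i)) \<le> 0" using \<phi>(2) that by simp
      then show ?thesis
        using moved[of i c] near0[of i] dist_triangle[of "\<sigma> c (a i)" "a i" "\<phi> (c, i)"] that \<open>0 < \<epsilon>\<close>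
        by simp
    qed
    moreover have "\<exists>u. \<sigma> g u \<noteq> u" if g: "g \<notin> N" for g
    proof -
      \<comment> \<open>No \<open>N\<close>-translate of \<open>g\<close> is 0, so the length term
        keeps \<open>(g, 0)\<close> uniformly away from \<open>(0, 0)\<close>; hence
        \<open>\<sigma> g\<close> moves the image of \<open>(0, 0)\<close>.\<close>
      have "min M \<eta> \<le> d (g, 0) (0, 0)"
      proof (rule d_ge)
        fix c assume "c \<in> N"
        then have "c + g \<noteq> 0" using g Nminus by (metis add_eq_0_iff)
        then have "1 \<le> real (l (c + g))" using l(4) by simp
        then have "\<eta> \<le> \<eta> * real (l (c + g))" using \<eta> by simp
        then have "\<eta> \<le> dist (\<psi> (tr c (g, 0))) (\<psi> (0, 0)) + \<eta> * real (l (c + g))"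
          by (rule add_increasing[OF zero_le_dist])
        then show "min M \<eta> \<le> d1 (tr c (g, 0)) (0, 0)"
          by (simp add: d1_def min.coboundedI2)
      qed
      then have "0 < dist (\<phi> (g, 0)) (\<phi> (0, 0))" using \<phi>(2) m M0 \<eta> by simp
      then show ?thesis using \<sigma>0[of g 0] by (intro exI[of _ "\<phi> (0, 0)"]) auto
    qed
    ultimately show "\<exists>\<sigma>\<in>Hom_Iso. (\<forall>f\<in>F. \<forall>a\<in>A. dist (\<sigma> f a) (\<rho> f a) < \<epsilon>) \<and>
        (\<forall>c\<in>N. \<forall>a\<in>A. dist (\<sigma> c a) a < \<epsilon>) \<and> (\<forall>g. g \<notin> N \<longrightarrow> (\<exists>u. \<sigma> g u \<noteq> u))"
      using \<sigma>(1) unfolding a by (intro bexI[of _ \<sigma>]) auto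
  qed
qed

section \<open>Nowhere dense sets of actions\<close>

text \<open>Serves at two levels: for the product over the group and for pointwise convergence of
  maps of the space.\<close>

lemma open_fun_basic_nbhd:
  fixes W :: "('i \<Rightarrow> 'b::topological_space) set"
  assumes "open W" "h \<in> W"
  shows "\<exists>X. (\<forall>i. open (X i) \<and> h i \<in> X i) \<and> finite {i. X i \<noteq> UNIV} \<and>
    (\<forall>k. (\<forall>i. X i \<noteq> UNIV \<longrightarrow> k i \<in> X i) \<longrightarrow> k \<in> W)"
proof -
  have "openin (product_topology (\<lambda>i. euclidean) UNIV) W"
    using assms by (simp add: open_fun_def)
  from product_topology_open_contains_basis[OF this assms(2)] obtain X where
    X: "h \<in> (\<Pi>\<^sub>E i\<in>UNIV. X i)" "\<And>i. open (X i)" "finite {i. X i \<noteq> UNIV}" "(\<Pi>\<^sub>E i\<in>UNIV. X i) \<subseteq> W"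
    by auto
  have "k \<in> W" if "\<forall>i. X i \<noteq> UNIV \<longrightarrow> k i \<in> X i" for k
    using that X(4) by (force simp: PiE_UNIV_domain)
  then show ?thesis using X by (intro exI[of _ X]) (auto simp: PiE_UNIV_domain)
qed

text \<open>The radius is given as an eventuality at 0 so that finitely many such conditions can be
  met by one radius.\<close>

lemma open_fun_metric_nbhd:
  fixes V :: "('a \<Rightarrow> 'b::metric_space) set"
  assumes "open V" "h \<in> V"
  shows "\<exists>A. finite A \<and> (\<forall>\<^sub>F \<epsilon> in at_right 0. \<forall>k. (\<forall>a\<in>A. dist (k a) (h a) < \<epsilon>) \<longrightarrow> k \<in> V)"
proof -
  obtain X where X: "\<And>i. open (X i)" "\<And>i. h i \<in> X i" "finite {i. X i \<noteq> UNIV}"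
    "\<And>k. (\<And>i. X i \<noteq> UNIV \<Longrightarrow> k i \<in> X i) \<Longrightarrow> k \<in> V"
    using open_fun_basic_nbhd[OF assms] by blast
  have "\<forall>\<^sub>F \<epsilon> in at_right 0. \<forall>y. dist y (h i) < \<epsilon> \<longrightarrow> y \<in> X i" for i
  proof -
    obtain e where "0 < e" "\<And>y. dist y (h i) < e \<Longrightarrow> y \<in> X i"
      using X(1,2) unfolding open_dist by blast
    then show ?thesis unfolding eventually_at_right_field by (intro exI[of _ e]) auto
  qed
  then have "\<forall>\<^sub>F \<epsilon> in at_right 0. \<forall>i\<in>{i. X i \<noteq> UNIV}. \<forall>y. dist y (h i) < \<epsilon> \<longrightarrow> y \<in> X i"
    using X(3) by (intro eventually_ball_finite) auto
  then have "\<forall>\<^sub>F \<epsilon> in at_right 0. \<forall>k. (\<forall>a\<in>{i. X i \<noteq> UNIV}. dist (k a) (h a) < \<epsilon>) \<longrightarrow> k \<in> V"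
    by eventually_elim (use X(4) in blast)
  then show ?thesis using X(3) by blast
qed

lemma open_action_nbhd:
  fixes W :: "('g \<Rightarrow> 'u \<Rightarrow> 'u::metric_space) set"
  assumes "open W" "\<rho> \<in> W"
  shows "\<exists>F A \<epsilon>. finite F \<and> finite A \<and> 0 < \<epsilon> \<and>
    (\<forall>\<sigma>. (\<forall>f\<in>F. \<forall>a\<in>A. dist (\<sigma> f a) (\<rho> f a) < \<epsilon>) \<longrightarrow> \<sigma> \<in> W)"
proof -
  obtain X where X: "\<And>i. open (X i)" "\<And>i. \<rho> i \<in> X i" "finite {i. X i \<noteq> UNIV}"
    "\<And>k. (\<And>i. X i \<noteq> UNIV \<Longrightarrow> k i \<in> X i) \<Longrightarrow> k \<in> W"
    using open_fun_basic_nbhd[OF assms] by blast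
  have "\<forall>i. \<exists>A. finite A \<and>
      (\<forall>\<^sub>F \<epsilon> in at_right 0. \<forall>k. (\<forall>a\<in>A. dist (k a) (\<rho> i a) < \<epsilon>) \<longrightarrow> k \<in> X i)"
    by (intro allI open_fun_metric_nbhd X)
  from choice[OF this] obtain A where A: "\<forall>i. finite (A i) \<and>
      (\<forall>\<^sub>F \<epsilon> in at_right 0. \<forall>k. (\<forall>a\<in>A i. dist (k a) (\<rho> i a) < \<epsilon>) \<longrightarrow> k \<in> X i)" ..
  let ?F = "{i. X i \<noteq> UNIV}"
  have "\<forall>\<^sub>F \<epsilon> in at_right 0. \<forall>i\<in>?F. \<forall>k. (\<forall>a\<in>A i. dist (k a) (\<rho> i a) < \<epsilon>) \<longrightarrow> k \<in> X i"
    using X(3) by (intro eventually_ball_finite) (simp_all add: A)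
  moreover have "\<forall>\<^sub>F \<epsilon> in at_right 0. (0::real) < \<epsilon>" by (rule eventually_at_right_less)
  ultimately have "\<forall>\<^sub>F \<epsilon> in at_right 0. 0 < \<epsilon> \<and>
      (\<forall>i\<in>?F. \<forall>k. (\<forall>a\<in>A i. dist (k a) (\<rho> i a) < \<epsilon>) \<longrightarrow> k \<in> X i)"
    by eventually_elim simp
  from eventually_happens'[OF trivial_limit_at_right_real this] obtain \<epsilon> where "0 < \<epsilon>"
      and \<epsilon>: "\<forall>i\<in>?F. \<forall>k. (\<forall>a\<in>A i. dist (k a) (\<rho> i a) < \<epsilon>) \<longrightarrow> k \<in> X i" by blast
  have "\<sigma> \<in> W" if "\<forall>f\<in>?F. \<forall>a\<in>\<Union>(A ` ?F). dist (\<sigma> f a) (\<rho> f a) < \<epsilon>" for \<sigma>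
    by (rule X(4), rule \<epsilon>[rule_format]) (use that in auto)
  then show ?thesis using X(3) A \<open>0 < \<epsilon>\<close> by (intro exI[of _ ?F] exI[of _ "\<Union>(A ` ?F)"]) auto
qed

text \<open>The trace of a closed set is its own relative closure, and \<open>escape\<close> finds
  points outside it in every basic neighbourhood, so its interior is empty.\<close>

lemma nowhere_dense_actions:
  fixes S :: "('g::ab_group_add \<Rightarrow> 'u \<Rightarrow> 'u::metric_space) set"
  assumes "closed S"
    and escape: "\<And>\<rho> F A \<epsilon>. \<rho> \<in> Hom_Iso \<Longrightarrow> finite F \<Longrightarrow> finite A \<Longrightarrow> 0 < \<epsilon> \<Longrightarrow>
      \<exists>\<sigma>\<in>Hom_Iso - S. \<forall>f\<in>F. \<forall>a\<in>A. dist (\<sigma> f a) (\<rho> f a) < \<epsilon>"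
  shows "nowhere_dense_in (top_of_set Hom_Iso) (Hom_Iso \<inter> S)"
proof -
  have "closedin (top_of_set Hom_Iso) (Hom_Iso \<inter> S)"
    using \<open>closed S\<close> by (rule closedin_closed_Int)
  then have cl: "top_of_set Hom_Iso closure_of (Hom_Iso \<inter> S) = Hom_Iso \<inter> S"
    by (rule closure_of_closedin)
  have "\<rho> \<notin> top_of_set Hom_Iso interior_of (Hom_Iso \<inter> S)" for \<rho>
  proof
    assume "\<rho> \<in> top_of_set Hom_Iso interior_of (Hom_Iso \<inter> S)"
    then obtain V where "openin (top_of_set Hom_Iso) V" "\<rho> \<in> V" "V \<subseteq> Hom_Iso \<inter> S"
      unfolding interior_of_def by blast
    then obtain W where W: "open W" "\<rho> \<in> W" "\<rho> \<in> Hom_Iso" "Hom_Iso \<inter> W \<subseteq> S"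
      unfolding openin_open by blast
    obtain F A \<epsilon> where "finite F" "finite A" "0 < \<epsilon>"
      "\<And>\<sigma>. (\<forall>f\<in>F. \<forall>a\<in>A. dist (\<sigma> f a) (\<rho> f a) < \<epsilon>) \<Longrightarrow> \<sigma> \<in> W"
      using open_action_nbhd[OF W(1,2)] by blast
    with escape[OF W(3)] W(4) show False by blast
  qed
  then show ?thesis unfolding nowhere_dense_in_def cl by auto
qed

lemma closed_fixing: "closed {\<rho> :: 'g \<Rightarrow> 'u \<Rightarrow> 'u::metric_space. \<forall>u. \<rho> g u = u}"
proof -
  have "continuous_on UNIV (\<lambda>\<rho> :: 'g \<Rightarrow> 'u \<Rightarrow> 'u. \<rho> g u)" for u
    by (intro continuous_on_product_then_coordinatewise[of _ "\<lambda>\<rho>. \<rho> g"] continuous_on_product_coordinates)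
  then show ?thesis
    by (intro closed_Collect_all closed_Collect_eq continuous_on_const)
qed

lemma closed_displacing:
  "closed {\<rho> :: 'g \<Rightarrow> 'u \<Rightarrow> 'u::metric_space. \<forall>n\<in>S. \<delta> \<le> dist (\<rho> (g n) u) u}"
proof -
  have "continuous_on UNIV (\<lambda>\<rho> :: 'g \<Rightarrow> 'u \<Rightarrow> 'u. \<rho> (g n) u)" for n
    by (intro continuous_on_product_then_coordinatewise[of _ "\<lambda>\<rho>. \<rho> (g n)"] continuous_on_product_coordinates)
  then have "closed {\<rho> :: 'g \<Rightarrow> 'u \<Rightarrow> 'u. \<delta> \<le> dist (\<rho> (g n) u) u}" for n
    by (intro closed_Collect_le continuous_intros)
  then have "closed (\<Inter>n\<in>S. {\<rho> :: 'g \<Rightarrow> 'u \<Rightarrow> 'u. \<delta> \<le> dist (\<rho> (g n) u) u})" by auto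
  moreover have "(\<Inter>n\<in>S. {\<rho> :: 'g \<Rightarrow> 'u \<Rightarrow> 'u. \<delta> \<le> dist (\<rho> (g n) u) u}) =
      {\<rho>. \<forall>n\<in>S. \<delta> \<le> dist (\<rho> (g n) u) u}" by auto
  ultimately show ?thesis by simp
qed

text \<open>The approximation applied with the trivial subgroup yields an action in which every
  non-zero element, \<open>x\<close> among them, acts non-trivially.\<close>

lemma nowhere_dense_fixing:
  fixes x :: "'g::{ab_group_add, countable}"
  assumes U: "urysohn_space TYPE('u::metric_space)" and "x \<noteq> 0"
  shows "nowhere_dense_in (top_of_set Hom_Iso)
    (Hom_Iso \<inter> {\<rho> :: 'g \<Rightarrow> 'u \<Rightarrow> 'u. \<forall>u. \<rho> x u = u})"
proof (rule nowhere_dense_actions[OF closed_fixing])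
  fix \<rho> :: "'g \<Rightarrow> 'u \<Rightarrow> 'u" and F :: "'g set" and A :: "'u set" and \<epsilon> :: real
  assume \<rho>: "\<rho> \<in> Hom_Iso" "finite F" and "finite A" and \<epsilon>: "0 < \<epsilon>"
  \<comment> \<open>An arbitrary point is added because the approximation asks for a non-empty set
    of points.\<close>
  then have "finite (insert undefined A)" "insert undefined A \<noteq> {}" by auto
  from subgroup_trivial_approximation[OF U \<rho> this \<epsilon>]
  obtain B where B: "\<forall>N. additive_subgroup N \<longrightarrow> N \<inter> B \<subseteq> {0} \<longrightarrow>
     (\<exists>\<sigma>\<in>Hom_Iso. (\<forall>f\<in>F. \<forall>a\<in>insert undefined A. dist (\<sigma> f a) (\<rho> f a) < \<epsilon>) \<and>
        (\<forall>c\<in>N. \<forall>a\<in>insert undefined A. dist (\<sigma> c a) a < \<epsilon>) \<and> (\<forall>g. g \<notin> N \<longrightarrow> (\<exists>u. \<sigma> g u \<noteq> u)))"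
    by blast
  have "additive_subgroup {0 :: 'g}" by (simp add: additive_subgroup_def)
  from B[rule_format, OF this] obtain \<sigma> where "\<sigma> \<in> Hom_Iso" "\<forall>f\<in>F. \<forall>a\<in>A. dist (\<sigma> f a) (\<rho> f a) < \<epsilon>"
    "\<forall>g. g \<notin> {0} \<longrightarrow> (\<exists>u. \<sigma> g u \<noteq> u)"
    by auto
  then show "\<exists>\<sigma>\<in>Hom_Iso - {\<rho>. \<forall>u. \<rho> x u = u}. \<forall>f\<in>F. \<forall>a\<in>A. dist (\<sigma> f a) (\<rho> f a) < \<epsilon>"
    using \<open>x \<noteq> 0\<close> by (intro bexI[of _ \<sigma>]) auto
qed

text \<open>For some \<open>n\<close> in \<open>S\<close> the cyclic subgroup generated by
  \<open>multiple n x\<close> avoids the exceptional finite set. An approximating action that is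
  almost trivial on this subgroup moves \<open>u\<close> by less than
  \<open>\<delta>\<close>.\<close>

lemma nowhere_dense_displacing:
  fixes x :: "'g::{ab_group_add, countable}" and u :: "'u::metric_space"
  assumes U: "urysohn_space TYPE('u)" and x: "torsion_free TYPE('g)" "x \<noteq> 0"
    and S: "infinite S" and "0 < \<delta>"
  shows "nowhere_dense_in (top_of_set Hom_Iso)
    (Hom_Iso \<inter> {\<rho>. \<forall>n\<in>S. \<delta> \<le> dist (\<rho> (multiple n x) u) u})"
proof (rule nowhere_dense_actions[OF closed_displacing])
  fix \<rho> :: "'g \<Rightarrow> 'u \<Rightarrow> 'u" and F :: "'g set" and A :: "'u set" and \<epsilon> :: real
  assume \<rho>: "\<rho> \<in> Hom_Iso" and fin: "finite F" "finite A" and "0 < \<epsilon>"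
  have "0 < min \<epsilon> \<delta>" "finite (insert u A)" "insert u A \<noteq> {}"
    using \<open>0 < \<epsilon>\<close> \<open>0 < \<delta>\<close> fin by auto
  from subgroup_trivial_approximation[OF U \<rho> fin(1) this(2,3,1)]
  obtain B where "finite B" and B: "\<forall>N. additive_subgroup N \<longrightarrow> N \<inter> B \<subseteq> {0} \<longrightarrow>
     (\<exists>\<sigma>\<in>Hom_Iso. (\<forall>f\<in>F. \<forall>a\<in>insert u A. dist (\<sigma> f a) (\<rho> f a) < min \<epsilon> \<delta>) \<and>
        (\<forall>c\<in>N. \<forall>a\<in>insert u A. dist (\<sigma> c a) a < min \<epsilon> \<delta>) \<and> (\<forall>g. g \<notin> N \<longrightarrow> (\<exists>u. \<sigma> g u \<noteq> u)))"
    by blast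
  obtain n where n: "n \<in> S" "multiples (multiple n x) \<inter> B \<subseteq> {0}"
    using multiples_avoid_finite[OF x \<open>finite B\<close> S] by blast
  from B[rule_format, OF additive_subgroup_multiples n(2)]
  obtain \<sigma> where \<sigma>: "\<sigma> \<in> Hom_Iso" "\<forall>f\<in>F. \<forall>a\<in>insert u A. dist (\<sigma> f a) (\<rho> f a) < min \<epsilon> \<delta>"
      "\<forall>c\<in>multiples (multiple n x). \<forall>a\<in>insert u A. dist (\<sigma> c a) a < min \<epsilon> \<delta>"
    by auto
  then have "dist (\<sigma> (multiple n x) u) u < \<delta>" using self_in_multiples by fastforce
  then show "\<exists>\<sigma>\<in>Hom_Iso - {\<rho>. \<forall>n\<in>S. \<delta> \<le> dist (\<rho> (multiple n x) u) u}.
      \<forall>f\<in>F. \<forall>a\<in>A. dist (\<sigma> f a) (\<rho> f a) < \<epsilon>"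
    using \<sigma> n by (intro bexI[of _ \<sigma>]) (auto simp: not_le)
qed

section \<open>Covering a conjugacy class by nowhere dense sets\<close>

lemma infinitely_often_displaced:
  assumes \<pi>: "\<pi> \<in> Hom_Iso" and "\<pi> x \<noteq> id"
  shows "\<exists>a \<delta>. 0 < \<delta> \<and> infinite {n. \<delta> \<le> dist (\<pi> (multiple n x) a) a}"
proof (rule ccontr)
  assume contra: "\<not> ?thesis"
  have "\<pi> x a = a" for a
  proof -
    let ?X = "\<lambda>n. \<pi> (multiple n x) a"
    have X: "?X \<longlonglongrightarrow> a"
    proof (rule tendstoI)
      fix e :: real assume "0 < e"
      then have "finite {n. e \<le> dist (?X n) a}" using contra by blast
      then show "\<forall>\<^sub>F n in sequentially. dist (?X n) a < e"
        unfolding cofinite_eq_sequentially[symmetric] eventually_cofinite by (simp add: not_less)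
    qed
    then have "(\<lambda>n. dist (?X n) a) \<longlonglongrightarrow> 0" by (rule tendsto_dist_iff[THEN iffD1])
    \<comment> \<open>\<open>?X (Suc n)\<close> is the image of \<open>?X n\<close> under the
      isometry \<open>\<pi> x\<close>, so this is the same sequence of distances.\<close>
    then have "(\<lambda>n. dist (?X (Suc n)) (\<pi> x a)) \<longlonglongrightarrow> 0"
      using Hom_Iso_props[OF \<pi>] by simp
    then have "(\<lambda>n. ?X (Suc n)) \<longlonglongrightarrow> \<pi> x a" by (rule tendsto_dist_iff[THEN iffD2])
    moreover have "(\<lambda>n. ?X (Suc n)) \<longlonglongrightarrow> a" using X by (rule LIMSEQ_Suc)
    ultimately show ?thesis by (rule LIMSEQ_unique)
  qed
  then show False using \<open>\<pi> x \<noteq> id\<close> by auto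
qed

lemma conj_orbit_subset_Hom_Iso:
  assumes \<pi>: "\<pi> \<in> Hom_Iso"
  shows "conj_orbit \<pi> \<subseteq> Hom_Iso"
proof
  fix \<rho> assume "\<rho> \<in> conj_orbit \<pi>"
  then obtain g where g: "g \<in> Iso" and \<rho>: "\<rho> = (\<lambda>\<gamma>. g \<circ> \<pi> \<gamma> \<circ> inv g)"
    unfolding conj_orbit_def by auto
  have bij: "bij g" and iso: "\<And>x y. dist (g x) (g y) = dist x y" using g by (auto simp: Iso_def)
  have gi: "g (inv g x) = x" "inv g (g x) = x" for x
    using bij by (simp_all add: bij_is_surj surj_f_inv_f bij_is_inj)
  have inv_iso: "dist (inv g x) (inv g y) = dist x y" for x y
    using iso[of "inv g x" "inv g y"] by (simp add: gi)
  have "bij (\<pi> c)" for c using \<pi> by (auto simp: Hom_Iso_def Iso_def)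
  then have "bij (\<rho> c)" for c unfolding \<rho> using bij bij_imp_bij_inv by (intro bij_comp) auto
  then show "\<rho> \<in> Hom_Iso"
    unfolding Hom_Iso_def Iso_def
    by (auto simp: \<rho> iso inv_iso gi Hom_Iso_props[OF \<pi>] fun_eq_iff)
qed

theorem theorem8p10:
  fixes \<pi> :: "'g::{ab_group_add, countable} \<Rightarrow> ('u::metric_space \<Rightarrow> 'u)"
  assumes "urysohn_space TYPE('u)"
    and "\<exists>x::'g. x \<noteq> 0"
    and "torsion_free TYPE('g)"
    and "\<pi> \<in> Hom_Iso"
  shows "meager_in (top_of_set (Hom_Iso :: ('g \<Rightarrow> ('u \<Rightarrow> 'u)) set)) (conj_orbit \<pi>)"
proof -
  obtain x :: 'g where x: "x \<noteq> 0" using assms(2) by blast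
  note orbit = conj_orbit_subset_Hom_Iso[OF assms(4)]
  show ?thesis
  proof (cases "\<pi> x = id")
    case True
    have "\<rho> x u = u" if "\<rho> \<in> conj_orbit \<pi>" for \<rho> u
      using that True by (auto simp: conj_orbit_def Iso_def bij_is_surj surj_f_inv_f)
    then have "conj_orbit \<pi> \<subseteq> \<Union>{Hom_Iso \<inter> {\<rho>. \<forall>u. \<rho> x u = u}}" using orbit by auto
    then show ?thesis
      unfolding meager_in_def using nowhere_dense_fixing[OF assms(1) x]
      by (intro exI[of _ "{Hom_Iso \<inter> {\<rho>. \<forall>u. \<rho> x u = u}}"]) simp
  next
    case False
    then obtain a \<delta> where "0 < \<delta>" and inf: "infinite {n. \<delta> \<le> dist (\<pi> (multiple n x) a) a}"
      using infinitely_often_displaced[OF assms(4)] by blast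
    let ?S = "{n. \<delta> \<le> dist (\<pi> (multiple n x) a) a}"
    obtain b :: "nat \<Rightarrow> 'u" where b: "\<And>u \<epsilon>. 0 < \<epsilon> \<Longrightarrow> \<exists>k. dist (b k) u < \<epsilon>"
      using urysohn_dense_sequence[OF assms(1)] by blast
    \<comment> \<open>The displaced point of a conjugate is \<open>g a\<close>, which ranges over
      uncountably many possibilities; points \<open>b k\<close> of a dense sequence replace it. An
      approximation within \<open>\<delta> / 4\<close> is paid for twice, which leaves a
      displacement of \<open>\<delta> / 2\<close>.\<close>
    define C where
      "C k = Hom_Iso \<inter> {\<rho> :: 'g \<Rightarrow> 'u \<Rightarrow> 'u. \<forall>n\<in>?S. \<delta> / 2 \<le> dist (\<rho> (multiple n x) (b k)) (b k)}" for k
    have "nowhere_dense_in (top_of_set Hom_Iso) (C k)" for k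
      unfolding C_def using \<open>0 < \<delta>\<close> by (intro nowhere_dense_displacing assms(1,3) x inf) simp
    moreover have "conj_orbit \<pi> \<subseteq> \<Union>(range C)"
    proof
      fix \<rho> assume \<rho>: "\<rho> \<in> conj_orbit \<pi>"
      then obtain g where g: "g \<in> Iso" "\<rho> = (\<lambda>\<gamma>. g \<circ> \<pi> \<gamma> \<circ> inv g)" unfolding conj_orbit_def by auto
      have H: "\<rho> \<in> Hom_Iso" using \<rho> orbit by auto
      have "0 < \<delta> / 4" using \<open>0 < \<delta>\<close> by simp
      then obtain k where k: "dist (b k) (g a) < \<delta> / 4" using b by blast
      have "\<delta> / 2 \<le> dist (\<rho> (multiple n x) (b k)) (b k)" if "n \<in> ?S" for n
      proof -
        let ?h = "\<rho> (multiple n x)"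
        have "dist (?h (g a)) (g a) = dist (\<pi> (multiple n x) a) a"
          using g by (simp add: Iso_def bij_is_inj)
        moreover have "dist (?h (b k)) (?h (g a)) = dist (b k) (g a)"
          by (rule Hom_Iso_props(3)[OF H])
        ultimately show ?thesis
          using that k dist_triangle[of "?h (g a)" "g a" "b k"]
            dist_triangle[of "?h (g a)" "b k" "?h (b k)"] by (simp add: dist_commute)
      qed
      then show "\<rho> \<in> \<Union>(range C)" using H unfolding C_def by blast
    qed
    ultimately show ?thesis
      unfolding meager_in_def by (intro exI[of _ "range C"]) auto
  qed
qed

end
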